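(* Let $\mathcal{K}$ be a countable index set and let $\mathcal{Z}$ be a separable Hilbert space. (1) Let $\mathcal{B}$ be a Banach space, $\mathcal{H}$ a separable Hilbert space, $\{x_k\}_{k\in\mathcal{K}}\subset\mathcal{B}$, and let $\mathfrak{b}:\mathcal{H}\times\mathcal{B}\to\mathcal{Z}$ be a continuous bilinear mapping. Then $(\{x_k\}_{k\in\mathcal{K}},\mathfrak{b})$ is a b-frame (respectively, b-Riesz basis) for $\mathcal{Z}$ if and only if $\{\Lambda_k:z\mapsto\langle z/x_k\rangle\}_{k\in\mathcal{K}}$ is a g-frame (respectively, g-Riesz basis) for $\mathcal{Z}$ with respect to the sequence of Hilbert spaces $\{\mathcal{Z}_k=\overline{\operatorname{range}(\Lambda_k)}\}_{k\in\mathcal{K}}$. (2) Let $\{\mathcal{Z}_k\}_{k\in\mathcal{K}}$ be a sequence of Hilbert spaces, let $\Lambda_k\in\mathcal{L}(\mathcal{Z},\mathcal{Z}_k)$ for $k\in\mathcal{K}$, and let $\mathcal{H}=\bigoplus_{k\in\mathcal{K}}\mathcal{Z}_k$. Then $\{\Lambda_k\}_{k\in\mathcal{K}}$ is a g-frame (respectively, g-Riesz basis) for $\mathcal{Z}$ with respect to $\{\mathcal{Z}_k\}_{k\in\mathcal{K}}$ if and only if $(\{x_k:\mathcal{H}\to\mathcal{Z}\}_{k\in\mathcal{K}},\mathfrak{b}_0)$ is a b-frame (respectively, b-Riesz basis) for $\mathcal{Z}$, where $x_k(h)=\Lambda_k^*(h)$ for all $h\in\mathcal{Z}_k$ and $\ker(x_k)=\mathcal{Z}_k^{\perp}$.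 In each of (1) and (2), the b-frame and the g-frame share the same bounds, and the b-frame operator coincides with the g-frame operator.
   Context: $\mathcal{L}(X,Y)$ denotes the bounded linear operators from $X$ to $Y$. For a continuous bilinear mapping $\mathfrak{b}:\mathcal{H}\times\mathcal{B}\to\mathcal{Z}$ (i.e. $\|\mathfrak{b}(h,x)\|\le M\|h\|\|x\|$ for some $M>0$), the b-frame product $\langle z/x\rangle\in\mathcal{H}$ of $z\in\mathcal{Z}$ and $x\in\mathcal{B}$ is the unique vector with $\langle\mathfrak{b}(h,x),z\rangle_{\mathcal{Z}}=\langle h,\langle z/x\rangle\rangle_{\mathcal{H}}$ for all $h\in\mathcal{H}$. The system $(\{x_k\}_{k\in\mathcal{K}},\mathfrak{b})$ with $x_k\in\mathcal{B}$ is a b-frame for $\mathcal{Z}$ with b-frame bounds $A,B>0$ if $A\|z\|_{\mathcal{Z}}^2\le\sum_{k}\|\langle z/x_k\rangle\|_{\mathcal{H}}^2\le B\|z\|_{\mathcal{Z}}^2$ for all $z\in\mathcal{Z}$; its b-frame operator is $S(z)=\sum_{k}\mathfrak{b}(\langle z/x_k\rangle,x_k)$. It is a b-basis for $\mathcal{Z}$ if each $z\in\mathcal{Z}$ has a unique representation $z=\sum_k\mathfrak{b}(h_k,x_k)$ with $h_k\in\mathcal{H}$, and a b-Riesz basis for $\mathcal{Z}$ if it is both a b-frame and a b-basis. $\mathfrak{b}_0:\mathcal{H}\times\mathcal{L}(\mathcal{H},\mathcal{Z})\to\mathcal{Z}$ is the continuous bilinear mapping $\mathfrak{b}_0(h,T)=T(h)$.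 A family $\{\Lambda_k\in\mathcal{L}(\mathcal{Z},\mathcal{Z}_k)\}_{k\in\mathcal{K}}$ is a g-frame for $\mathcal{Z}$ with respect to $\{\mathcal{Z}_k\}_{k\in\mathcal{K}}$ with g-frame bounds $A,B>0$ if $A\|z\|_{\mathcal{Z}}^2\le\sum_{k}\|\Lambda_k(z)\|_{\mathcal{Z}_k}^2\le B\|z\|_{\mathcal{Z}}^2$ for all $z\in\mathcal{Z}$; its g-frame operator is $z\mapsto\sum_k\Lambda_k^*\Lambda_k(z)$. It is a g-Riesz basis for $\mathcal{Z}$ with respect to $\{\mathcal{Z}_k\}$ (standard definition, W. Sun) if $\{z:\Lambda_kz=0\ \forall k\}=\{0\}$ and there are $A,B>0$ such that $A\sum_{k\in F}\|g_k\|^2\le\|\sum_{k\in F}\Lambda_k^*g_k\|^2\le B\sum_{k\in F}\|g_k\|^2$ for every finite $F\subset\mathcal{K}$ and all $g_k\in\mathcal{Z}_k$. $\bigoplus_{k\in\mathcal{K}}\mathcal{Z}_k$ is the Hilbert space direct sum $\{\sum_kh_k:h_k\in\mathcal{Z}_k,\ \sum_k\|h_k\|^2<\infty\}$ with inner product $\langle\sum_kh_k,\sum_kh_k'\rangle=\sum_k\langle h_k,h_k'\rangle_{\mathcal{Z}_k}$; each $\mathcal{Z}_k$ is identified with a closed subspace of it, and $\mathcal{Z}_k^{\perp}$ is the orthogonal complement in $\mathcal{H}$.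
   Formalization: In "b-basis", uniqueness of the representation z=∑b(h_k,x_k) is taken to mean uniqueness of the summands b(h_k,x_k), not of the vectors h_k; with unique h_k the Riesz-basis claim fails, e.g. in (2) for the two coordinate functionals on C². *)

theory Defs
  imports "HOL-Analysis.Analysis"
begin

text \<open>
  The scalar field may be the real or the complex numbers. Both are instances of the following
  class, and by the Gelfand-Mazur theorem it has no others up to isomorphism.
\<close>

class real_or_complex_field = real_normed_field +
  fixes conjg :: "'a \<Rightarrow> 'a"
  assumes conjg_add: "conjg (x + y) = conjg x + conjg y"
    and conjg_mult: "conjg (x * y) = conjg x * conjg y"
    and conjg_conjg: "conjg (conjg x) = x"
    and mult_conjg: "x * conjg x = (norm x)\<^sup>2 *\<^sub>R 1"

instantiation real :: real_or_complex_field
begin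
definition conjg_real :: "real \<Rightarrow> real" where "conjg_real x = x"
instance by standard (auto simp: conjg_real_def power2_eq_square)
end

instantiation complex :: real_or_complex_field
begin
definition conjg_complex :: "complex \<Rightarrow> complex" where "conjg_complex = cnj"
instance by standard
  (auto simp: conjg_complex_def complex_norm_square scaleR_conv_of_real simp flip: of_real_power)
end

text \<open>
  Normed and Hilbert spaces over such a field \<open>'f\<close>. Norm, topology and completeness are those of
  the underlying type; the scalar multiplication extends the real one. Over the real numbers
  \<open>scale\<close> and \<open>ip\<close> are necessarily \<open>scaleR\<close> and \<open>inner\<close>.
\<close>

locale normed_space_over = vector_space scale
  for scale :: "'f::real_or_complex_field \<Rightarrow> 'a::real_normed_vector \<Rightarrow> 'a" +
  assumes scale_of_real: "scale (of_real r) x = r *\<^sub>R x"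
    and norm_scale: "norm (scale c x) = norm c * norm x"

locale hilbert_space_over = normed_space_over scale
  for scale :: "'f::real_or_complex_field \<Rightarrow> 'a::{real_inner, complete_space} \<Rightarrow> 'a" +
  fixes ip :: "'a \<Rightarrow> 'a \<Rightarrow> 'f"
  assumes ip_add_left: "ip (x + y) z = ip x z + ip y z"
    and ip_scale_left: "ip (scale c x) y = c * ip x y"
    and ip_commute: "ip y x = conjg (ip x y)"
    and ip_self: "ip x x = of_real ((norm x)\<^sup>2)"

lemma hilbert_space_over_real:
  "hilbert_space_over (scaleR :: real \<Rightarrow> 'a \<Rightarrow> 'a::{real_inner, complete_space}) inner"
  by unfold_locales
    (auto simp: algebra_simps inner_commute conjg_real_def power2_norm_eq_inner)

lemma hilbert_space_over_complex:
  "hilbert_space_over ((*) :: complex \<Rightarrow> complex \<Rightarrow> complex) (\<lambda>x y. x * cnj y)"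
  by unfold_locales
    (auto simp: algebra_simps conjg_complex_def norm_mult scaleR_conv_of_real
        complex_norm_square simp flip: of_real_power)

definition closed_subspace ::
    "('f::real_or_complex_field \<Rightarrow> 'a::real_normed_vector \<Rightarrow> 'a) \<Rightarrow> 'a set \<Rightarrow> bool" where
  "closed_subspace sc W \<longleftrightarrow> module.subspace sc W \<and> closed W"

definition orth_compl :: "('a \<Rightarrow> 'a \<Rightarrow> 'f::zero) \<Rightarrow> 'a set \<Rightarrow> 'a set" where
  "orth_compl ip W = {h. \<forall>g\<in>W. ip h g = 0}"

definition bounded_op ::
    "('f::real_or_complex_field \<Rightarrow> 'a::real_normed_vector \<Rightarrow> 'a) \<Rightarrow>
     ('f \<Rightarrow> 'b::real_normed_vector \<Rightarrow> 'b) \<Rightarrow> ('a \<Rightarrow> 'b) \<Rightarrow> bool" where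
  "bounded_op scA scB T \<longleftrightarrow>
     Vector_Spaces.linear scA scB T \<and> (\<exists>M. \<forall>x. norm (T x) \<le> M * norm x)"

definition continuous_bilinear ::
    "('f::real_or_complex_field \<Rightarrow> 'h::real_normed_vector \<Rightarrow> 'h) \<Rightarrow>
     ('f \<Rightarrow> 'b::real_normed_vector \<Rightarrow> 'b) \<Rightarrow> ('f \<Rightarrow> 'z::real_normed_vector \<Rightarrow> 'z) \<Rightarrow>
     ('h \<Rightarrow> 'b \<Rightarrow> 'z) \<Rightarrow> bool" where
  "continuous_bilinear scH scB scZ b \<longleftrightarrow>
     (\<forall>x. Vector_Spaces.linear scH scZ (\<lambda>h. b h x)) \<and>
     (\<forall>h. Vector_Spaces.linear scB scZ (\<lambda>x. b h x)) \<and>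
     (\<exists>M>0. \<forall>h x. norm (b h x) \<le> M * norm h * norm x)"

text \<open>
  For \<open>T\<close> with values in a closed subspace \<open>W\<close>, the adjoint of \<open>T\<close> as an operator into the Hilbert
  space \<open>W\<close> is the restriction to \<open>W\<close> of the operator below.
\<close>

definition adjoint_op :: "('a \<Rightarrow> 'a \<Rightarrow> 'f) \<Rightarrow> ('b \<Rightarrow> 'b \<Rightarrow> 'f) \<Rightarrow> ('a \<Rightarrow> 'b) \<Rightarrow> 'b \<Rightarrow> 'a" where
  "adjoint_op ipA ipB T y = (THE x. \<forall>a. ipB (T a) y = ipA a x)"

text \<open>
  Sums over the (unordered) index set are unconditional sums. In the frame inequalities
  summability is stated separately because \<open>infsum\<close> of a non-summable family is 0.
\<close>

definition b_frame_prod ::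
    "('h \<Rightarrow> 'h \<Rightarrow> 'f) \<Rightarrow> ('z \<Rightarrow> 'z \<Rightarrow> 'f) \<Rightarrow> ('h \<Rightarrow> 'b \<Rightarrow> 'z) \<Rightarrow> 'z \<Rightarrow> 'b \<Rightarrow> 'h" where
  "b_frame_prod ipH ipZ b z x = (THE g. \<forall>h. ipZ (b h x) z = ipH h g)"

definition b_frame_bounds ::
    "('h::real_normed_vector \<Rightarrow> 'h \<Rightarrow> 'f) \<Rightarrow> ('z::real_normed_vector \<Rightarrow> 'z \<Rightarrow> 'f) \<Rightarrow>
     ('h \<Rightarrow> 'b \<Rightarrow> 'z) \<Rightarrow> 'k set \<Rightarrow> ('k \<Rightarrow> 'b) \<Rightarrow> real \<Rightarrow> real \<Rightarrow> bool" where
  "b_frame_bounds ipH ipZ b K x A B \<longleftrightarrow> A > 0 \<and> B > 0 \<and>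
     (\<forall>z. (\<lambda>k. (norm (b_frame_prod ipH ipZ b z (x k)))\<^sup>2) summable_on K \<and>
          A * (norm z)\<^sup>2 \<le> (\<Sum>\<^sub>\<infinity>k\<in>K. (norm (b_frame_prod ipH ipZ b z (x k)))\<^sup>2) \<and>
          (\<Sum>\<^sub>\<infinity>k\<in>K. (norm (b_frame_prod ipH ipZ b z (x k)))\<^sup>2) \<le> B * (norm z)\<^sup>2)"

definition b_frame ::
    "('h::real_normed_vector \<Rightarrow> 'h \<Rightarrow> 'f) \<Rightarrow> ('z::real_normed_vector \<Rightarrow> 'z \<Rightarrow> 'f) \<Rightarrow>
     ('h \<Rightarrow> 'b \<Rightarrow> 'z) \<Rightarrow> 'k set \<Rightarrow> ('k \<Rightarrow> 'b) \<Rightarrow> bool" where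
  "b_frame ipH ipZ b K x \<longleftrightarrow> (\<exists>A B. b_frame_bounds ipH ipZ b K x A B)"

definition b_frame_operator ::
    "('h \<Rightarrow> 'h \<Rightarrow> 'f) \<Rightarrow> ('z::real_normed_vector \<Rightarrow> 'z \<Rightarrow> 'f) \<Rightarrow>
     ('h \<Rightarrow> 'b \<Rightarrow> 'z) \<Rightarrow> 'k set \<Rightarrow> ('k \<Rightarrow> 'b) \<Rightarrow> 'z \<Rightarrow> 'z" where
  "b_frame_operator ipH ipZ b K x z = (\<Sum>\<^sub>\<infinity>k\<in>K. b (b_frame_prod ipH ipZ b z (x k)) (x k))"

text \<open>
  Uniqueness of the representation \<open>z = \<Sum>k. b (h k) (x k)\<close> means uniqueness of the summands
  \<open>b (h k) (x k)\<close>, that is, of each \<open>h k\<close> modulo the kernel of \<open>\<lambda>h. b h (x k)\<close>. Asking for unique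
  vectors \<open>h k\<close> would force every \<open>\<lambda>h. b h (x k)\<close> to be injective. That already fails for the family
  \<open>x k\<close> built from the coordinate functionals of a two-dimensional \<open>\<Z>\<close>, where \<open>x k\<close> vanishes on
  the orthogonal complement of the \<open>k\<close>-th summand of the direct sum. When these maps are
  injective the two readings agree (lemma below).
\<close>

definition b_basis ::
    "('h \<Rightarrow> 'b \<Rightarrow> 'z::real_normed_vector) \<Rightarrow> 'k set \<Rightarrow> ('k \<Rightarrow> 'b) \<Rightarrow> bool" where
  "b_basis b K x \<longleftrightarrow>
     (\<forall>z. (\<exists>h. ((\<lambda>k. b (h k) (x k)) has_sum z) K) \<and>
          (\<forall>h h'. ((\<lambda>k. b (h k) (x k)) has_sum z) K \<longrightarrow>
                  ((\<lambda>k. b (h' k) (x k)) has_sum z) K \<longrightarrow>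
                  (\<forall>k\<in>K. b (h k) (x k) = b (h' k) (x k))))"

lemma b_basis_iff_unique_coefficients:
  assumes "\<And>k. k \<in> K \<Longrightarrow> inj (\<lambda>h. b h (x k))"
  shows "b_basis b K x \<longleftrightarrow>
     (\<forall>z. (\<exists>h. ((\<lambda>k. b (h k) (x k)) has_sum z) K) \<and>
          (\<forall>h h'. ((\<lambda>k. b (h k) (x k)) has_sum z) K \<longrightarrow>
                  ((\<lambda>k. b (h' k) (x k)) has_sum z) K \<longrightarrow> (\<forall>k\<in>K. h k = h' k)))"
proof -
  have "b (h k) (x k) = b (h' k) (x k) \<longleftrightarrow> h k = h' k" if "k \<in> K" for h h' k
    using injD[OF assms[OF that], of "h k" "h' k"] by auto
  then show ?thesis
    unfolding b_basis_def by simp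
qed

definition b_Riesz_basis ::
    "('h::real_normed_vector \<Rightarrow> 'h \<Rightarrow> 'f) \<Rightarrow> ('z::real_normed_vector \<Rightarrow> 'z \<Rightarrow> 'f) \<Rightarrow>
     ('h \<Rightarrow> 'b \<Rightarrow> 'z) \<Rightarrow> 'k set \<Rightarrow> ('k \<Rightarrow> 'b) \<Rightarrow> bool" where
  "b_Riesz_basis ipH ipZ b K x \<longleftrightarrow> b_frame ipH ipZ b K x \<and> b_basis b K x"

text \<open>
  \<open>g_system\<close> says that each \<open>\<Lambda> k\<close> is a bounded operator into the Hilbert space \<open>W k\<close>; the spaces
  \<open>W k\<close> are closed subspaces of a common Hilbert space.
\<close>

definition g_system ::
    "('f::real_or_complex_field \<Rightarrow> 'z::real_normed_vector \<Rightarrow> 'z) \<Rightarrow>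
     ('f \<Rightarrow> 'h::real_normed_vector \<Rightarrow> 'h) \<Rightarrow> 'k set \<Rightarrow> ('k \<Rightarrow> 'z \<Rightarrow> 'h) \<Rightarrow> ('k \<Rightarrow> 'h set) \<Rightarrow> bool" where
  "g_system scZ scH K \<Lambda> W \<longleftrightarrow>
     (\<forall>k\<in>K. closed_subspace scH (W k) \<and> bounded_op scZ scH (\<Lambda> k) \<and> range (\<Lambda> k) \<subseteq> W k)"

definition g_frame_bounds ::
    "('f::real_or_complex_field \<Rightarrow> 'z::real_normed_vector \<Rightarrow> 'z) \<Rightarrow>
     ('f \<Rightarrow> 'h::real_normed_vector \<Rightarrow> 'h) \<Rightarrow> 'k set \<Rightarrow> ('k \<Rightarrow> 'z \<Rightarrow> 'h) \<Rightarrow> ('k \<Rightarrow> 'h set) \<Rightarrow>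
     real \<Rightarrow> real \<Rightarrow> bool" where
  "g_frame_bounds scZ scH K \<Lambda> W A B \<longleftrightarrow> g_system scZ scH K \<Lambda> W \<and> A > 0 \<and> B > 0 \<and>
     (\<forall>z. (\<lambda>k. (norm (\<Lambda> k z))\<^sup>2) summable_on K \<and>
          A * (norm z)\<^sup>2 \<le> (\<Sum>\<^sub>\<infinity>k\<in>K. (norm (\<Lambda> k z))\<^sup>2) \<and>
          (\<Sum>\<^sub>\<infinity>k\<in>K. (norm (\<Lambda> k z))\<^sup>2) \<le> B * (norm z)\<^sup>2)"

definition g_frame ::
    "('f::real_or_complex_field \<Rightarrow> 'z::real_normed_vector \<Rightarrow> 'z) \<Rightarrow>
     ('f \<Rightarrow> 'h::real_normed_vector \<Rightarrow> 'h) \<Rightarrow> 'k set \<Rightarrow> ('k \<Rightarrow> 'z \<Rightarrow> 'h) \<Rightarrow> ('k \<Rightarrow> 'h set) \<Rightarrow> bool" where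
  "g_frame scZ scH K \<Lambda> W \<longleftrightarrow> (\<exists>A B. g_frame_bounds scZ scH K \<Lambda> W A B)"

definition g_frame_operator ::
    "('z::real_normed_vector \<Rightarrow> 'z \<Rightarrow> 'f) \<Rightarrow> ('h \<Rightarrow> 'h \<Rightarrow> 'f) \<Rightarrow> 'k set \<Rightarrow> ('k \<Rightarrow> 'z \<Rightarrow> 'h) \<Rightarrow> 'z \<Rightarrow> 'z" where
  "g_frame_operator ipZ ipH K \<Lambda> z = (\<Sum>\<^sub>\<infinity>k\<in>K. adjoint_op ipZ ipH (\<Lambda> k) (\<Lambda> k z))"

definition g_Riesz_basis ::
    "('f::real_or_complex_field \<Rightarrow> 'z::real_normed_vector \<Rightarrow> 'z) \<Rightarrow> ('z \<Rightarrow> 'z \<Rightarrow> 'f) \<Rightarrow>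
     ('f \<Rightarrow> 'h::real_normed_vector \<Rightarrow> 'h) \<Rightarrow> ('h \<Rightarrow> 'h \<Rightarrow> 'f) \<Rightarrow>
     'k set \<Rightarrow> ('k \<Rightarrow> 'z \<Rightarrow> 'h) \<Rightarrow> ('k \<Rightarrow> 'h set) \<Rightarrow> bool" where
  "g_Riesz_basis scZ ipZ scH ipH K \<Lambda> W \<longleftrightarrow> g_system scZ scH K \<Lambda> W \<and>
     {z. \<forall>k\<in>K. \<Lambda> k z = 0} = {0} \<and>
     (\<exists>A>0. \<exists>B>0. \<forall>F g. finite F \<longrightarrow> F \<subseteq> K \<longrightarrow> (\<forall>k\<in>F. g k \<in> W k) \<longrightarrow>
        A * (\<Sum>k\<in>F. (norm (g k))\<^sup>2) \<le> (norm (\<Sum>k\<in>F. adjoint_op ipZ ipH (\<Lambda> k) (g k)))\<^sup>2 \<and>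
        (norm (\<Sum>k\<in>F. adjoint_op ipZ ipH (\<Lambda> k) (g k)))\<^sup>2 \<le> B * (\<Sum>k\<in>F. (norm (g k))\<^sup>2))"

text \<open>
  The whole space is the Hilbert space direct sum of its closed subspaces \<open>W k\<close>: it consists of
  the sums of the square-summable families, with the componentwise inner product.
\<close>

definition square_summable_family ::
    "'k set \<Rightarrow> ('k \<Rightarrow> 'h::real_normed_vector set) \<Rightarrow> ('k \<Rightarrow> 'h) \<Rightarrow> bool" where
  "square_summable_family K W g \<longleftrightarrow>
     (\<forall>k\<in>K. g k \<in> W k) \<and> (\<lambda>k. (norm (g k))\<^sup>2) summable_on K"

definition hilbert_direct_sum ::
    "('f::real_or_complex_field \<Rightarrow> 'h::real_normed_vector \<Rightarrow> 'h) \<Rightarrow> ('h \<Rightarrow> 'h \<Rightarrow> 'f) \<Rightarrow>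
     'k set \<Rightarrow> ('k \<Rightarrow> 'h set) \<Rightarrow> bool" where
  "hilbert_direct_sum scH ipH K W \<longleftrightarrow>
     (\<forall>k\<in>K. closed_subspace scH (W k)) \<and>
     (\<forall>g. square_summable_family K W g \<longrightarrow> g summable_on K) \<and>
     (\<forall>h. \<exists>g. square_summable_family K W g \<and> (g has_sum h) K) \<and>
     (\<forall>g g'. square_summable_family K W g \<longrightarrow> square_summable_family K W g' \<longrightarrow>
        ((\<lambda>k. ipH (g k) (g' k)) has_sum ipH (\<Sum>\<^sub>\<infinity>k\<in>K. g k) (\<Sum>\<^sub>\<infinity>k\<in>K. g' k)) K)"

text \<open>
  The operators \<open>x k\<close> of the g-frame/b-frame correspondence equal the adjoint of \<open>\<Lambda> k\<close> on \<open>W k\<close>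
  and 0 on its orthogonal complement. Their kernel is exactly that complement iff \<open>\<Lambda> k\<close> has dense
  range in \<open>W k\<close>; only the implication from b-Riesz to g-Riesz basis needs this. For instance the
  embedding of the scalar field as the first axis of a two-dimensional \<open>W k\<close> (one index) gives
  a b-Riesz basis but not a g-Riesz basis.
\<close>

definition b0 :: "'h::real_normed_vector \<Rightarrow> ('h \<Rightarrow>\<^sub>L 'z::real_normed_vector) \<Rightarrow> 'z" where
  "b0 h T = blinfun_apply T h"

end

theory Submission
  imports Defs
begin

text \<open>
  Put \<open>T k = (\<lambda>h. b h (x k))\<close>. Then \<open>z \<mapsto> \<langle>z/x k\<rangle>\<close> is the adjoint of \<open>T k\<close>, so the b-frame and
  g-frame inequalities, and the two frame operators, are literally the same; in the second part the
  adjoint of \<open>x k\<close> is \<open>\<Lambda> k\<close> because \<open>x k\<close> vanishes on the orthogonal complement of \<open>\<Z> k\<close>.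

  For Riesz bases, the frame operator \<open>S\<close> is coercive and hence onto. If the \<open>T k\<close> form a basis,
  a finite sum \<open>\<Sum> T k (g k) = S w\<close> has coefficients \<open>g k = \<Lambda> k w\<close> by uniqueness, which gives the
  lower Riesz bound. Conversely, the Riesz bounds give the frame inequality on the finite sums
  \<open>\<Sum> T k (g k)\<close>; these are dense by completeness of \<open>\<Lambda>\<close>, so the inequality holds everywhere and
  surjectivity of \<open>S\<close> provides the expansions. As
  \<open>2 Re (ip u v)\<close> is \<open>2 * inner u v\<close>, all estimates can be made with the real inner product.
\<close>

section \<open>Projections and representation in real Hilbert spaces\<close>

text \<open>Near-minimisers of the distance to \<open>x\<close> form decreasing closed sets whose
  diameters shrink by the parallelogram law. Completeness gives a common point \<open>p\<close>, and
  its minimality along the line through \<open>p\<close> in direction \<open>w\<close> gives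
  orthogonality.\<close>

lemma orthogonal_decomposition:
  fixes W :: "'a::{real_inner, complete_space} set"
  assumes "subspace W" "closed W"
  obtains p where "p \<in> W" "\<And>w. w \<in> W \<Longrightarrow> inner (x - p) w = 0"
proof -
  define \<delta> where "\<delta> = (INF w\<in>W. (norm (x - w))\<^sup>2)"
  define S where "S n = {w \<in> W. (norm (x - w))\<^sup>2 \<le> \<delta> + 1 / real (Suc n)}" for n
  have \<delta>_le: "\<delta> \<le> (norm (x - w))\<^sup>2" if "w \<in> W" for w
    unfolding \<delta>_def by (rule cINF_lower[OF _ that]) (auto intro!: bdd_belowI[of _ 0])
  obtain p where p: "\<And>n. p \<in> S n"
  proof (rule decreasing_closed_nest[of S])
    show "closed (S n)" for n
    proof -
      have "S n = W \<inter> {w. (norm (x - w))\<^sup>2 \<le> \<delta> + 1 / real (Suc n)}"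
        by (auto simp: S_def)
      moreover have "closed {w. (norm (x - w))\<^sup>2 \<le> \<delta> + 1 / real (Suc n)}"
        by (intro closed_Collect_le continuous_intros)
      ultimately show ?thesis
        using assms by auto
    qed
    show "S n \<noteq> {}" for n
    proof -
      have "\<exists>w\<in>W. (norm (x - w))\<^sup>2 < \<delta> + 1 / real (Suc n)"
        using assms(1) unfolding \<delta>_def
        by (subst cINF_less_iff[symmetric])
          (auto intro!: bdd_belowI[of _ 0] dest: subspace_0)
      then show ?thesis
        unfolding S_def by (auto intro: less_imp_le)
    qed
    show "S n \<subseteq> S m" if "m \<le> n" for m n
    proof -
      have "1 / real (Suc n) \<le> 1 / real (Suc m)"
        using that by (intro divide_left_mono) auto
      then show ?thesis
        unfolding S_def by auto
    qed
    show "\<exists>n. \<forall>u\<in>S n. \<forall>v\<in>S n. dist u v < e" if "e > 0" for e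
    proof -
      have "e\<^sup>2 / 4 > 0"
        using that by simp
      from reals_Archimedean[OF this] obtain n where n: "1 / real (Suc n) < e\<^sup>2 / 4"
        unfolding inverse_eq_divide by blast
      have "dist u v < e" if "u \<in> S n" "v \<in> S n" for u v
      proof -
        have "(1/2) *\<^sub>R (u + v) \<in> W"
          using that assms(1) by (auto simp: S_def intro!: subspace_scale subspace_add)
        then have "\<delta> \<le> (norm (x - (1/2) *\<^sub>R (u + v)))\<^sup>2"
          by (rule \<delta>_le)
        \<comment> \<open>Parallelogram law; since the midpoint lies in \<open>W\<close>, the right
          side is at most \<open>4 / real (Suc n)\<close>.\<close>
        moreover have "(norm (u - v))\<^sup>2 =
            2 * (norm (x - u))\<^sup>2 + 2 * (norm (x - v))\<^sup>2 - 4 * (norm (x - (1/2) *\<^sub>R (u + v)))\<^sup>2"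
          unfolding power2_norm_eq_inner by (simp add: algebra_simps inner_commute)
        ultimately have "(norm (u - v))\<^sup>2 < e\<^sup>2"
          using that n by (simp add: S_def)
        then show ?thesis
          using \<open>e > 0\<close> by (simp add: dist_norm power2_less_imp_less)
      qed
      then show ?thesis by blast
    qed
  qed blast
  have p_min: "(norm (x - p))\<^sup>2 \<le> \<delta>"
  proof (rule field_le_epsilon)
    fix e :: real assume "e > 0"
    then obtain n where "1 / real (Suc n) < e"
      using reals_Archimedean by (auto simp: inverse_eq_divide)
    then show "(norm (x - p))\<^sup>2 \<le> \<delta> + e"
      using p[of n] by (simp add: S_def)
  qed
  have "p \<in> W"
    using p by (simp add: S_def)
  moreover have "inner (x - p) w = 0" if "w \<in> W" for w
  proof (cases "w = 0")
    case False
    \<comment> \<open>This value minimises the squared distance from \<open>x\<close> to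
      \<open>p + t *\<^sub>R w\<close>, a quadratic polynomial in \<open>t\<close>.\<close>
    define t where "t = inner (x - p) w / (norm w)\<^sup>2"
    have "p + t *\<^sub>R w \<in> W"
      using \<open>p \<in> W\<close> that assms(1) by (intro subspace_add subspace_scale)
    then have "(norm (x - p))\<^sup>2 \<le> (norm (x - (p + t *\<^sub>R w)))\<^sup>2"
      using p_min \<delta>_le by (meson order_trans)
    also have "\<dots> = (norm (x - p))\<^sup>2 - 2 * t * inner (x - p) w + t\<^sup>2 * (norm w)\<^sup>2"
      unfolding power2_norm_eq_inner
      by (simp add: algebra_simps inner_commute power2_eq_square)
    also have "\<dots> = (norm (x - p))\<^sup>2 - (inner (x - p) w)\<^sup>2 / (norm w)\<^sup>2"
      using False by (simp add: t_def field_simps power2_eq_square)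
    finally show ?thesis
      using False by (simp add: divide_le_0_iff)
  qed simp
  ultimately show ?thesis
    using that by blast
qed

text \<open>The kernel of a nonzero functional has codimension one, so a nonzero vector
  \<open>u\<close> orthogonal to it represents \<phi> up to a scalar, which is fixed by comparing
  values at \<open>u\<close>.\<close>

lemma riesz_representation:
  fixes \<phi> :: "'a::{real_inner, complete_space} \<Rightarrow> real"
  assumes "bounded_linear \<phi>"
  obtains g where "\<And>h. \<phi> h = inner h g"
proof (cases "\<forall>h. \<phi> h = 0")
  case True
  then show ?thesis
    using that[of 0] by simp
next
  case False
  then obtain x where x: "\<phi> x \<noteq> 0" by blast
  interpret bounded_linear \<phi> by fact
  have "subspace {h. \<phi> h = 0}"
    by (auto simp: subspace_def zero add scale)
  moreover have "closed {h. \<phi> h = 0}"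
    by (intro closed_Collect_eq continuous_on continuous_intros tendsto)
  ultimately obtain p where p: "\<phi> p = 0" "\<And>w. \<phi> w = 0 \<Longrightarrow> inner (x - p) w = 0"
    using orthogonal_decomposition[of "{h. \<phi> h = 0}" x] by auto
  define u where "u = x - p"
  have u: "\<phi> u \<noteq> 0" "u \<noteq> 0"
    using x p(1) by (auto simp: u_def diff)
  have "\<phi> h = inner h ((\<phi> u / inner u u) *\<^sub>R u)" for h
  proof -
    \<comment> \<open>This combination of \<open>u\<close> and \<open>h\<close> is annihilated by
      \<phi>; its orthogonality to \<open>u\<close> can be solved for
      \<open>\<phi> h\<close>.\<close>
    have "inner u (\<phi> h *\<^sub>R u - \<phi> u *\<^sub>R h) = 0"
      unfolding u_def by (rule p(2)) (simp add: diff scale)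
    then show ?thesis
      using u by (simp add: inner_diff_right inner_commute field_simps)
  qed
  then show ?thesis
    by (rule that)
qed

lemma subspace_closure:
  fixes S :: "'a::real_normed_vector set"
  assumes "subspace S"
  shows "subspace (closure S)"
proof (rule subspaceI)
  show "0 \<in> closure S"
    using subspace_0[OF assms] closure_subset by blast
  show "x + y \<in> closure S" if "x \<in> closure S" "y \<in> closure S" for x y
  proof -
    from that obtain f g where "\<And>n. f n \<in> S" "f \<longlonglongrightarrow> x" "\<And>n. g n \<in> S" "g \<longlonglongrightarrow> y"
      by (metis closure_sequential)
    then show ?thesis
      unfolding closure_sequential
      by (intro exI[of _ "\<lambda>n. f n + g n"]) (auto intro: tendsto_add subspace_add[OF assms])
  qed
  show "c *\<^sub>R x \<in> closure S" if "x \<in> closure S" for c x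
  proof -
    from that obtain f where "\<And>n. f n \<in> S" "f \<longlonglongrightarrow> x"
      by (metis closure_sequential)
    then show ?thesis
      unfolding closure_sequential
      by (intro exI[of _ "\<lambda>n. c *\<^sub>R f n"]) (auto intro: tendsto_scaleR subspace_scale[OF assms])
  qed
qed

text \<open>A Cauchy criterion for the net of finite sums: what lies outside a large
  \<open>F0\<close> is controlled by a tail of \<open>a\<close>. The domination concerns whole
  finite sums and not single terms, because frame expansions converge unconditionally but in general
  not absolutely.\<close>

lemma square_dominated_summable_on:
  fixes f :: "'k \<Rightarrow> 'a::{real_inner, complete_space}" and a :: "'k \<Rightarrow> real"
  assumes "a summable_on K" "B > 0"
    and le: "\<And>F. finite F \<Longrightarrow> F \<subseteq> K \<Longrightarrow> (norm (sum f F))\<^sup>2 \<le> B * sum a F"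
  shows "f summable_on K"
proof -
  have "cauchy_filter (filtermap (sum f) (finite_subsets_at_top K))"
    unfolding cauchy_filter_metric_filtermap
  proof (intro allI impI)
    fix e :: real assume "e > 0"
    \<comment> \<open>Chosen so that \<open>B * d\<close> is \<open>(e / 2)\<^sup>2\<close>;
      comparing two sums with the one over \<open>F0\<close> then costs \<open>e\<close>.\<close>
    define d where "d = e\<^sup>2 / (4 * B)"
    have "d > 0" using \<open>e > 0\<close> \<open>B > 0\<close> by (simp add: d_def)
    obtain l where "filtermap (sum a) (finite_subsets_at_top K) \<le> nhds l"
      using assms(1) unfolding summable_on_def has_sum_def filterlim_def by blast
    then have "cauchy_filter (filtermap (sum a) (finite_subsets_at_top K))"
      by (rule nhds_imp_cauchy_filter)
    then obtain P where P: "eventually P (finite_subsets_at_top K)"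
        "\<And>F G. P F \<Longrightarrow> P G \<Longrightarrow> dist (sum a F) (sum a G) < d"
      unfolding cauchy_filter_metric_filtermap using \<open>d > 0\<close> by meson
    obtain F0 where F0: "finite F0" "F0 \<subseteq> K"
        "\<And>F. finite F \<Longrightarrow> F0 \<subseteq> F \<Longrightarrow> F \<subseteq> K \<Longrightarrow> P F"
      using P(1)[unfolded eventually_finite_subsets_at_top] by (elim exE conjE) simp
    have near: "dist (sum f F) (sum f F0) < e / 2" if F: "finite F" "F0 \<subseteq> F" "F \<subseteq> K" for F
    proof -
      have "(norm (sum f (F - F0)))\<^sup>2 \<le> B * sum a (F - F0)"
        using F by (intro le) auto
      also have "sum a (F - F0) = sum a F - sum a F0"
        using F F0 by (simp add: sum_diff)
      also have "\<dots> < d"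
        using P(2)[of F F0] F0 F by (auto simp: dist_real_def)
      also have "B * d = (e / 2)\<^sup>2"
        using \<open>B > 0\<close> by (simp add: d_def power_divide)
      finally have "norm (sum f (F - F0)) < e / 2"
        using \<open>e > 0\<close> \<open>B > 0\<close> by (intro power2_less_imp_less[of _ "e / 2"]) auto
      then show ?thesis
        using F F0 by (simp add: dist_norm sum_diff)
    qed
    define Q where "Q F \<longleftrightarrow> finite F \<and> F0 \<subseteq> F \<and> F \<subseteq> K" for F
    have "eventually Q (finite_subsets_at_top K)"
      unfolding eventually_finite_subsets_at_top Q_def using F0(1,2) by (intro exI[of _ F0]) simp
    moreover have "dist (sum f F) (sum f G) < e" if "Q F" "Q G" for F G
      using that by (intro dist_triangle_half_l[OF near near]) (auto simp: Q_def)
    ultimately show "\<exists>P. eventually P (finite_subsets_at_top K) \<and>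
        (\<forall>F G. P F \<and> P G \<longrightarrow> dist (sum f F) (sum f G) < e)"
      by (intro exI[of _ Q]) simp
  qed
  moreover have "complete (UNIV :: 'a set)"
    by (meson Cauchy_convergent UNIV_I complete_def convergent_def)
  ultimately obtain l where "(sum f \<longlongrightarrow> l) (finite_subsets_at_top K)"
    using complete_uniform[where S = "UNIV :: 'a set"] by (force simp: filterlim_def)
  then show ?thesis
    unfolding summable_on_def has_sum_def by blast
qed

section \<open>Families of adjoint operators\<close>

text \<open>Stated on finite subsets, so that it can be established before any summability is
  known.\<close>

definition bessel_bound :: "'k set \<Rightarrow> ('k \<Rightarrow> 'z::real_normed_vector \<Rightarrow> 'h::real_normed_vector) \<Rightarrow> real \<Rightarrow> bool" where
  "bessel_bound K L B \<longleftrightarrow>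
     (\<forall>F z. finite F \<longrightarrow> F \<subseteq> K \<longrightarrow> (\<Sum>k\<in>F. (norm (L k z))\<^sup>2) \<le> B * (norm z)\<^sup>2)"

text \<open>The analytic content common to \<open>b_frame_bounds\<close> and
  \<open>g_frame_bounds\<close>.\<close>

definition frame_bounds :: "'k set \<Rightarrow> ('k \<Rightarrow> 'z::real_normed_vector \<Rightarrow> 'h::real_normed_vector) \<Rightarrow> real \<Rightarrow> real \<Rightarrow> bool" where
  "frame_bounds K L A B \<longleftrightarrow> A > 0 \<and> B > 0 \<and>
     (\<forall>z. (\<lambda>k. (norm (L k z))\<^sup>2) summable_on K \<and>
          A * (norm z)\<^sup>2 \<le> (\<Sum>\<^sub>\<infinity>k\<in>K. (norm (L k z))\<^sup>2) \<and>
          (\<Sum>\<^sub>\<infinity>k\<in>K. (norm (L k z))\<^sup>2) \<le> B * (norm z)\<^sup>2)"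

text \<open>The inequality of \<open>g_Riesz_basis\<close> with \<open>T k\<close> in place of the
  adjoint of \<open>\<Lambda> k\<close>. The constants are parameters because the same pair
  reappears in \<open>frame_bounds\<close>.\<close>

definition riesz_bounds ::
    "'k set \<Rightarrow> ('k \<Rightarrow> 'h::real_normed_vector \<Rightarrow> 'z::real_normed_vector) \<Rightarrow> ('k \<Rightarrow> 'h set) \<Rightarrow> real \<Rightarrow> real \<Rightarrow> bool" where
  "riesz_bounds K T V A B \<longleftrightarrow> A > 0 \<and> B > 0 \<and>
     (\<forall>F g. finite F \<longrightarrow> F \<subseteq> K \<longrightarrow> (\<forall>k\<in>F. g k \<in> V k) \<longrightarrow>
        A * (\<Sum>k\<in>F. (norm (g k))\<^sup>2) \<le> (norm (\<Sum>k\<in>F. T k (g k)))\<^sup>2 \<and>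
        (norm (\<Sum>k\<in>F. T k (g k)))\<^sup>2 \<le> B * (\<Sum>k\<in>F. (norm (g k))\<^sup>2))"

definition total_on :: "'k set \<Rightarrow> ('k \<Rightarrow> 'z::zero \<Rightarrow> 'h::zero) \<Rightarrow> bool" where
  "total_on K L \<longleftrightarrow> {z. \<forall>k\<in>K. L k z = 0} = {0}"

lemma frame_bounds_imp_bessel_bound:
  assumes "frame_bounds K L A B"
  shows "bessel_bound K L B"
  unfolding bessel_bound_def
proof (intro allI impI)
  fix F z assume F: "finite F" "F \<subseteq> K"
  have "(\<Sum>k\<in>F. (norm (L k z))\<^sup>2) \<le> (\<Sum>\<^sub>\<infinity>k\<in>K. (norm (L k z))\<^sup>2)"
    using assms F by (intro finite_sum_le_infsum) (auto simp: frame_bounds_def)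
  also have "\<dots> \<le> B * (norm z)\<^sup>2"
    using assms by (simp add: frame_bounds_def)
  finally show "(\<Sum>k\<in>F. (norm (L k z))\<^sup>2) \<le> B * (norm z)\<^sup>2" .
qed

text \<open>Cauchy-Schwarz twice: for each term in the space, then for the two families of
  norms.\<close>

lemma inner_sum_square_le:
  fixes u v :: "'k \<Rightarrow> 'a::real_inner"
  shows "(\<Sum>k\<in>F. inner (u k) (v k))\<^sup>2 \<le> (\<Sum>k\<in>F. (norm (u k))\<^sup>2) * (\<Sum>k\<in>F. (norm (v k))\<^sup>2)"
proof -
  have "\<bar>\<Sum>k\<in>F. inner (u k) (v k)\<bar> \<le> (\<Sum>k\<in>F. norm (u k) * norm (v k))"
    by (rule order_trans[OF sum_abs sum_mono[OF Cauchy_Schwarz_ineq2]])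
  then have "(\<Sum>k\<in>F. inner (u k) (v k))\<^sup>2 \<le> (\<Sum>k\<in>F. norm (u k) * norm (v k))\<^sup>2"
    by (rule abs_le_square_iff[THEN iffD1, OF order_trans]) simp
  also have "\<dots> \<le> (\<Sum>k\<in>F. (norm (u k))\<^sup>2) * (\<Sum>k\<in>F. (norm (v k))\<^sup>2)"
    by (rule Cauchy_Schwarz_ineq_sum)
  finally show ?thesis .
qed

lemma power2_le_if_mult_power2_le:
  fixes a b :: real
  assumes "a\<^sup>2 * a\<^sup>2 \<le> b * a\<^sup>2" "b \<ge> 0"
  shows "a\<^sup>2 \<le> b"
proof (cases "a = 0")
  case False
  then have "a\<^sup>2 > 0" by simp
  with assms(1) show ?thesis
    by (rule mult_right_le_imp_le)
qed (use assms in simp)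

text \<open>The real setting for all estimates. \<open>V k\<close> is any closed subspace containing
  the range of \<open>L k\<close>, which covers both the closure of the range and a prescribed
  target space. \<open>T k\<close> lives on the whole space; its restriction to \<open>V k\<close>
  is the adjoint of \<open>L k\<close> as an operator into \<open>V k\<close>.\<close>

locale adjoint_family =
  fixes K :: "'k set"
    and T :: "'k \<Rightarrow> 'h::{real_inner, complete_space} \<Rightarrow> 'z::{real_inner, complete_space}"
    and L :: "'k \<Rightarrow> 'z \<Rightarrow> 'h"
    and V :: "'k \<Rightarrow> 'h set"
  assumes adj: "k \<in> K \<Longrightarrow> inner (T k h) z = inner h (L k z)"
    and linear_T: "k \<in> K \<Longrightarrow> bounded_linear (T k)"
    and linear_L: "k \<in> K \<Longrightarrow> bounded_linear (L k)"
    and subspace_V: "k \<in> K \<Longrightarrow> subspace (V k)"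
    and closed_V: "k \<in> K \<Longrightarrow> closed (V k)"
    and L_in_V: "k \<in> K \<Longrightarrow> L k z \<in> V k"
begin

lemmas T_simps = linear_simps[OF linear_T]

lemmas L_simps = linear_simps[OF linear_L]

section \<open>Bessel bounds and the frame operator\<close>

definition frame_op :: "'z \<Rightarrow> 'z" where
  "frame_op z = (\<Sum>\<^sub>\<infinity>k\<in>K. T k (L k z))"

lemma inner_synthesis:
  assumes "F \<subseteq> K"
  shows "inner (\<Sum>k\<in>F. T k (g k)) z = (\<Sum>k\<in>F. inner (g k) (L k z))"
  using assms by (auto simp: inner_sum_left adj intro!: sum.cong)

text \<open>Synthesis is adjoint to analysis and inherits its bound: pair the sum with itself, move
  \<open>T k\<close> across the inner product, apply Cauchy-Schwarz and the Bessel bound, and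
  cancel.\<close>

lemma synthesis_bound:
  assumes "bessel_bound K L B" "B \<ge> 0" "finite F" "F \<subseteq> K"
  shows "(norm (\<Sum>k\<in>F. T k (g k)))\<^sup>2 \<le> B * (\<Sum>k\<in>F. (norm (g k))\<^sup>2)"
proof (rule power2_le_if_mult_power2_le)
  let ?y = "\<Sum>k\<in>F. T k (g k)"
  have "(norm ?y)\<^sup>2 * (norm ?y)\<^sup>2 = (\<Sum>k\<in>F. inner (g k) (L k ?y))\<^sup>2"
    using inner_synthesis[OF assms(4), of g ?y]
    by (simp add: power2_norm_eq_inner flip: power2_eq_square)
  also have "\<dots> \<le> (\<Sum>k\<in>F. (norm (g k))\<^sup>2) * (\<Sum>k\<in>F. (norm (L k ?y))\<^sup>2)"
    by (rule inner_sum_square_le)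
  also have "\<dots> \<le> (\<Sum>k\<in>F. (norm (g k))\<^sup>2) * (B * (norm ?y)\<^sup>2)"
    using assms by (intro mult_left_mono sum_nonneg) (auto simp: bessel_bound_def)
  finally show "(norm ?y)\<^sup>2 * (norm ?y)\<^sup>2 \<le> B * (\<Sum>k\<in>F. (norm (g k))\<^sup>2) * (norm ?y)\<^sup>2"
    by (simp add: mult_ac)
qed (use assms in \<open>auto intro!: mult_nonneg_nonneg sum_nonneg\<close>)

text \<open>The dual argument: the coefficients \<open>L k z\<close> lie in \<open>V k\<close>, so
  the upper Riesz bound applies to them, and pairing their synthesis with \<open>z\<close> returns
  the sum of squares.\<close>

lemma riesz_bounds_imp_bessel_bound:
  assumes "riesz_bounds K T V A B"
  shows "bessel_bound K L B"
  unfolding bessel_bound_def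
proof (intro allI impI)
  fix F z assume F: "finite F" "F \<subseteq> K"
  let ?y = "\<Sum>k\<in>F. T k (L k z)" and ?s = "\<Sum>k\<in>F. (norm (L k z))\<^sup>2"
  have B: "B \<ge> 0"
    using assms by (simp add: riesz_bounds_def)
  have "?s = inner ?y z"
    using F by (simp add: inner_synthesis power2_norm_eq_inner)
  then have "?s\<^sup>2 \<le> (norm ?y * norm z)\<^sup>2"
    by (metis Cauchy_Schwarz_ineq2 abs_le_square_iff abs_mult abs_norm_cancel)
  also have "\<dots> \<le> (B * ?s) * (norm z)\<^sup>2"
    unfolding power_mult_distrib
    using assms F L_in_V by (intro mult_right_mono) (auto simp: riesz_bounds_def subset_iff)
  finally have *: "?s * ?s \<le> (B * (norm z)\<^sup>2) * ?s"
    by (simp add: power2_eq_square mult_ac)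
  have "?s \<ge> 0"
    by (simp add: sum_nonneg)
  then show "?s \<le> B * (norm z)\<^sup>2"
    using * B by (cases "?s = 0") (auto simp: mult_le_cancel_right)
qed

lemma summable_square_L:
  assumes "bessel_bound K L B"
  shows "(\<lambda>k. (norm (L k z))\<^sup>2) summable_on K"
  using assms unfolding bessel_bound_def
  by (intro nonneg_bdd_above_summable_on) (auto intro!: bdd_aboveI[of _ "B * (norm z)\<^sup>2"])

lemma infsum_square_L_le:
  assumes "bessel_bound K L B"
  shows "(\<Sum>\<^sub>\<infinity>k\<in>K. (norm (L k z))\<^sup>2) \<le> B * (norm z)\<^sup>2"
  using assms summable_square_L[OF assms] unfolding bessel_bound_def
  by (intro infsum_le_finite_sums) auto

lemma summable_frame_op:
  assumes "bessel_bound K L B" "B > 0"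
  shows "(\<lambda>k. T k (L k z)) summable_on K"
  using assms
  by (intro square_dominated_summable_on[OF summable_square_L[OF assms(1), of z]] synthesis_bound) auto

lemma has_sum_frame_op:
  assumes "bessel_bound K L B" "B > 0"
  shows "((\<lambda>k. T k (L k z)) has_sum frame_op z) K"
  unfolding frame_op_def using summable_frame_op[OF assms] by (rule has_sum_infsum)

text \<open>Turns the frame inequality into a statement about the quadratic form of
  \<open>frame_op\<close>: its lower half becomes coercivity.\<close>

lemma inner_frame_op:
  assumes "bessel_bound K L B" "B > 0"
  shows "inner (frame_op z) z = (\<Sum>\<^sub>\<infinity>k\<in>K. (norm (L k z))\<^sup>2)"
proof -
  have "((\<lambda>k. inner (T k (L k z)) z) has_sum inner (frame_op z) z) K"
    by (rule has_sum_bounded_linear[OF bounded_linear_inner_left has_sum_frame_op[OF assms]])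
  also have "?this \<longleftrightarrow> ((\<lambda>k. (norm (L k z))\<^sup>2) has_sum inner (frame_op z) z) K"
    by (intro has_sum_cong) (simp add: adj power2_norm_eq_inner)
  finally show ?thesis
    by (simp add: infsumI)
qed

text \<open>Analysis and synthesis each contribute a factor \<open>sqrt B\<close> on finite sums,
  and the bound passes to the limit. Linearity follows from uniqueness of sums.\<close>

lemma bounded_linear_frame_op:
  assumes "bessel_bound K L B" "B > 0"
  shows "bounded_linear frame_op"
    and norm_frame_op_le: "norm (frame_op z) \<le> B * norm z"
proof -
  note S = has_sum_frame_op[OF assms]
  show le: "norm (frame_op z) \<le> B * norm z" for z
  proof -
    have "(sum (\<lambda>k. T k (L k z)) \<longlongrightarrow> frame_op z) (finite_subsets_at_top K)"
      using S by (simp add: has_sum_def)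
    moreover have "eventually (\<lambda>F. norm (\<Sum>k\<in>F. T k (L k z)) \<le> B * norm z) (finite_subsets_at_top K)"
    proof (rule eventually_finite_subsets_at_top_weakI)
      fix F assume F: "finite F" "F \<subseteq> K"
      have "(norm (\<Sum>k\<in>F. T k (L k z)))\<^sup>2 \<le> B * (\<Sum>k\<in>F. (norm (L k z))\<^sup>2)"
        using assms F by (intro synthesis_bound) auto
      also have "\<dots> \<le> B * (B * (norm z)\<^sup>2)"
        using assms F by (intro mult_left_mono) (auto simp: bessel_bound_def)
      also have "\<dots> = (B * norm z)\<^sup>2"
        by (simp add: power_mult_distrib power2_eq_square[of B])
      finally show "norm (\<Sum>k\<in>F. T k (L k z)) \<le> B * norm z"
        by (rule power2_le_imp_le) (use assms(2) in simp)
    qed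
    ultimately show ?thesis
      by (rule Lim_norm_ubound[OF finite_subsets_at_top_neq_bot])
  qed
  show "bounded_linear frame_op"
  proof (rule bounded_linear_intro)
    show "frame_op (x + y) = frame_op x + frame_op y" for x y
    proof (rule has_sum_unique[OF S[of "x + y"]])
      show "((\<lambda>k. T k (L k (x + y))) has_sum frame_op x + frame_op y) K"
        using has_sum_add[OF S[of x] S[of y]]
        by (rule has_sum_cong[THEN iffD1, rotated])
          (simp add: T_simps L_simps)
    qed
    show "frame_op (r *\<^sub>R x) = r *\<^sub>R frame_op x" for r x
    proof (rule has_sum_unique[OF S[of "r *\<^sub>R x"]])
      show "((\<lambda>k. T k (L k (r *\<^sub>R x))) has_sum r *\<^sub>R frame_op x) K"
        using has_sum_bounded_linear[OF bounded_linear_scaleR_right S[of x]]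
        by (rule has_sum_cong[THEN iffD1, rotated])
          (simp add: T_simps L_simps)
    qed
    show "norm (frame_op x) \<le> norm x * B" for x
      using le[of x] by (simp add: mult.commute)
  qed
qed

text \<open>
  As in the Lax-Milgram theorem, \<open>w \<mapsto> w - t (S w - z)\<close> is a contraction for small \<open>t > 0\<close>. The bound
  \<open>C = A + B\<close> is used instead of \<open>B\<close> to have \<open>A < C\<close> also on the trivial space.
\<close>

lemma frame_op_surj:
  assumes "frame_bounds K L A B"
  shows "\<exists>w. frame_op w = z \<and> A * norm w \<le> norm z"
proof -
  have A: "A > 0" and B: "B > 0"
    and lower: "A * (norm w)\<^sup>2 \<le> (\<Sum>\<^sub>\<infinity>k\<in>K. (norm (L k w))\<^sup>2)" for w
    using assms by (auto simp: frame_bounds_def)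
  have bessel: "bessel_bound K L B"
    by (rule frame_bounds_imp_bessel_bound[OF assms])
  interpret S: bounded_linear frame_op
    by (rule bounded_linear_frame_op[OF bessel B])
  have coercive: "A * (norm w)\<^sup>2 \<le> inner (frame_op w) w" for w
    using lower inner_frame_op[OF bessel B] by simp
  define C where "C = A + B"
  have C: "C > A" "C > 0" "norm (frame_op w) \<le> C * norm w" for w
    using A B norm_frame_op_le[OF bessel B, of w] mult_right_mono[of B C "norm w"]
    by (auto simp: C_def)
  \<comment> \<open>The minimiser of \<open>1 - 2 * t * A + t\<^sup>2 * C\<^sup>2\<close>, the bound
    for the squared contraction factor; the minimum is the radicand in \<open>c\<close>.\<close>
  define t where "t = A / C\<^sup>2"
  define c where "c = sqrt (1 - (A / C)\<^sup>2)"
  have t: "t > 0" and AC: "0 < A / C" "A / C < 1"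
    using A C by (auto simp: t_def)
  have AC2: "0 < (A / C)\<^sup>2" "(A / C)\<^sup>2 < 1"
    using AC by (auto simp: power_less_one_iff simp del: power_divide)
  define f where "f w = w - t *\<^sub>R (frame_op w - z)" for w
  have "dist (f u) (f v) \<le> c * dist u v" for u v
  proof (rule power2_le_imp_le)
    define d where "d = u - v"
    have "(dist (f u) (f v))\<^sup>2 = (norm (d - t *\<^sub>R frame_op d))\<^sup>2"
      by (simp add: dist_norm f_def d_def S.diff algebra_simps)
    also have "\<dots> = (norm d)\<^sup>2 - 2 * t * inner (frame_op d) d + t\<^sup>2 * (norm (frame_op d))\<^sup>2"
      unfolding power2_norm_eq_inner
      by (simp add: algebra_simps inner_commute power2_eq_square)
    also have "\<dots> \<le> (norm d)\<^sup>2 - 2 * t * (A * (norm d)\<^sup>2) + t\<^sup>2 * (C * norm d)\<^sup>2"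
      using t coercive[of d] C(3)[of d] by (intro add_mono diff_mono mult_left_mono power_mono) auto
    also have "\<dots> = (1 - (A / C)\<^sup>2) * (norm d)\<^sup>2"
      using C(2) by (simp add: t_def field_simps power2_eq_square)
    also have "\<dots> = (c * dist u v)\<^sup>2"
      using AC2 by (simp add: c_def d_def dist_norm power_mult_distrib del: power_divide)
    finally show "(dist (f u) (f v))\<^sup>2 \<le> (c * dist u v)\<^sup>2" .
    show "0 \<le> c * dist u v"
      using AC2 by (simp add: c_def del: power_divide)
  qed
  moreover have "0 \<le> c" "c < 1"
    using AC2 by (auto simp: c_def simp del: power_divide)
  ultimately obtain w where "f w = w"
    using banach_fix_type[of c f] by blast
  then have w: "frame_op w = z"
    using t by (simp add: f_def)
  \<comment> \<open>The a priori estimate for the solution: coercivity against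
    Cauchy-Schwarz.\<close>
  have "A * (norm w)\<^sup>2 \<le> norm z * norm w"
    using coercive[of w] norm_cauchy_schwarz[of z w] unfolding w by linarith
  then have "A * norm w \<le> norm z"
    by (cases "w = 0") (auto simp: power2_eq_square)
  then show ?thesis
    using w by blast
qed

section \<open>Riesz bounds and bases\<close>

text \<open>\<open>T k\<close> vanishes on the orthogonal complement of \<open>V k\<close> because
  \<open>L k\<close> takes values in \<open>V k\<close>. This mediates between basis coefficients,
  which range over the whole space, and Riesz bounds, which speak of vectors in \<open>V k\<close>
  only.\<close>

lemma T_eq_at_projection:
  assumes "k \<in> K"
  obtains p where "p \<in> V k" "T k p = T k h"
proof -
  obtain p where p: "p \<in> V k" "\<And>w. w \<in> V k \<Longrightarrow> inner (h - p) w = 0"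
    using orthogonal_decomposition[OF subspace_V closed_V] assms by metis
  have "inner (T k (h - p)) y = 0" for y
    using p(2) L_in_V adj assms by simp
  then have "T k (h - p) = 0"
    by (metis inner_eq_zero_iff)
  then show ?thesis
    using that[of p] p(1) T_simps(2)[OF assms] by simp
qed

text \<open>A vector orthogonal to all finite sums is annihilated by every \<open>L k\<close>, hence
  zero by totality.\<close>

lemma finite_synthesis_dense:
  assumes "total_on K L"
  shows "closure {\<Sum>k\<in>F. T k (g k) | F g. finite F \<and> F \<subseteq> K \<and> (\<forall>k\<in>F. g k \<in> V k)} = UNIV"
    (is "closure ?R = UNIV")
proof -
  have R_I: "(\<Sum>k\<in>F. T k (g k)) \<in> ?R" if "finite F" "F \<subseteq> K" "\<forall>k\<in>F. g k \<in> V k" for F g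
    using that by (intro CollectI exI[of _ F] exI[of _ g] conjI refl)
  have "subspace ?R"
  proof (rule subspaceI)
    show "0 \<in> ?R"
      by (auto intro!: exI[of _ "{}"])
    fix x y assume "x \<in> ?R" "y \<in> ?R"
    then obtain F g G h where x: "x = (\<Sum>k\<in>F. T k (g k))" and F: "finite F" "F \<subseteq> K" "\<forall>k\<in>F. g k \<in> V k"
      and y: "y = (\<Sum>k\<in>G. T k (h k))" and G: "finite G" "G \<subseteq> K" "\<forall>k\<in>G. h k \<in> V k"
      by auto
    \<comment> \<open>Both families are padded by zero to the common index set
      \<open>F \<union> G\<close>.\<close>
    define g' where "g' k = (if k \<in> F then g k else 0)" for k
    define h' where "h' k = (if k \<in> G then h k else 0)" for k
    have "x = (\<Sum>k\<in>F \<union> G. T k (g' k))"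
      unfolding x g'_def using F G by (intro sum.mono_neutral_cong_left) (auto simp: T_simps)
    moreover have "y = (\<Sum>k\<in>F \<union> G. T k (h' k))"
      unfolding y h'_def using F G by (intro sum.mono_neutral_cong_left) (auto simp: T_simps)
    moreover have "(\<Sum>k\<in>F \<union> G. T k (g' k + h' k)) = (\<Sum>k\<in>F \<union> G. T k (g' k) + T k (h' k))"
      using F G by (intro sum.cong refl) (auto simp: T_simps)
    ultimately have "x + y = (\<Sum>k\<in>F \<union> G. T k (g' k + h' k))"
      by (simp add: sum.distrib)
    moreover have "\<forall>k\<in>F \<union> G. g' k + h' k \<in> V k"
      using F G subspace_V by (auto simp: g'_def h'_def subset_iff intro!: subspace_add subspace_0)
    ultimately show "x + y \<in> ?R"
      using F G R_I[of "F \<union> G" "\<lambda>k. g' k + h' k"] by simp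
  next
    fix c x assume "x \<in> ?R"
    then obtain F g where x: "x = (\<Sum>k\<in>F. T k (g k))" and F: "finite F" "F \<subseteq> K" "\<forall>k\<in>F. g k \<in> V k"
      by auto
    have "c *\<^sub>R x = (\<Sum>k\<in>F. T k (c *\<^sub>R g k))"
      unfolding x scaleR_sum_right using F by (auto intro!: sum.cong simp: T_simps)
    moreover have "\<forall>k\<in>F. c *\<^sub>R g k \<in> V k"
      using F subspace_V by (auto simp: subset_iff intro!: subspace_scale)
    ultimately show "c *\<^sub>R x \<in> ?R"
      using F R_I[of F "\<lambda>k. c *\<^sub>R g k"] by simp
  qed
  then have sub: "subspace (closure ?R)"
    by (rule subspace_closure)
  have "x \<in> closure ?R" for x
  proof -
    obtain p where p: "p \<in> closure ?R" "\<And>w. w \<in> closure ?R \<Longrightarrow> inner (x - p) w = 0"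
      using orthogonal_decomposition[OF sub] by auto
    have "L k (x - p) = 0" if k: "k \<in> K" for k
    proof -
      let ?v = "L k (x - p)"
      \<comment> \<open>Testing against \<open>T k ?v\<close> produces the squared norm of
        \<open>?v\<close>.\<close>
      have "T k ?v \<in> ?R"
        using R_I[of "{k}" "\<lambda>j. L j (x - p)"] k L_in_V by simp
      then have "inner (x - p) (T k ?v) = 0"
        by (intro p(2) subsetD[OF closure_subset])
      then show ?thesis
        using adj[OF k, of ?v "x - p"] by (simp add: inner_commute)
    qed
    then have "x - p = 0"
      using assms unfolding total_on_def by blast
    then show ?thesis
      using p(1) by simp
  qed
  then show ?thesis by blast
qed

text \<open>For a finite sum \<open>z\<close> with coefficients \<open>g k\<close>, write
  \<open>(norm z)\<^sup>2\<close> as the sum of \<open>inner (g k) (L k z)\<close>. Cauchy-Schwarz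
  and the lower Riesz bound for \<open>g\<close> give the lower frame bound at \<open>z\<close>;
  continuity of the quadratic form extends it from these dense vectors.\<close>

lemma riesz_bounds_imp_frame_bounds:
  assumes "riesz_bounds K T V A B" "total_on K L"
  shows "frame_bounds K L A B"
proof -
  have A: "A > 0" and B: "B > 0"
    using assms(1) by (auto simp: riesz_bounds_def)
  have bessel: "bessel_bound K L B"
    by (rule riesz_bounds_imp_bessel_bound[OF assms(1)])
  let ?R = "{\<Sum>k\<in>F. T k (g k) | F g. finite F \<and> F \<subseteq> K \<and> (\<forall>k\<in>F. g k \<in> V k)}"
  have "?R \<subseteq> {z. A * (norm z)\<^sup>2 \<le> inner (frame_op z) z}"
  proof safe
    fix F g assume F: "finite F" "F \<subseteq> K" "\<forall>k\<in>F. g k \<in> V k"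
    define z where "z = (\<Sum>k\<in>F. T k (g k))"
    let ?Q = "inner (frame_op z) z"
    have Q: "(\<Sum>k\<in>F. (norm (L k z))\<^sup>2) \<le> ?Q"
      unfolding inner_frame_op[OF bessel B]
      using F summable_square_L[OF bessel] by (intro finite_sum_le_infsum) auto
    have "A * ((norm z)\<^sup>2 * (norm z)\<^sup>2) = A * (\<Sum>k\<in>F. inner (g k) (L k z))\<^sup>2"
      using inner_synthesis[OF F(2), of g z]
      by (simp add: power2_norm_eq_inner z_def flip: power2_eq_square)
    also have "\<dots> \<le> A * ((\<Sum>k\<in>F. (norm (g k))\<^sup>2) * (\<Sum>k\<in>F. (norm (L k z))\<^sup>2))"
      using A by (intro mult_left_mono inner_sum_square_le) auto
    also have "\<dots> = (A * (\<Sum>k\<in>F. (norm (g k))\<^sup>2)) * (\<Sum>k\<in>F. (norm (L k z))\<^sup>2)"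
      by simp
    also have "\<dots> \<le> (norm z)\<^sup>2 * ?Q"
      using assms(1) F Q A unfolding z_def riesz_bounds_def
      by (intro mult_mono) (auto intro!: sum_nonneg)
    finally have *: "(A * (norm z)\<^sup>2) * (norm z)\<^sup>2 \<le> ?Q * (norm z)\<^sup>2"
      by (simp add: mult_ac)
    show "A * (norm z)\<^sup>2 \<le> ?Q"
    proof (cases "z = 0")
      case False
      then have "(norm z)\<^sup>2 > 0" by simp
      with * show ?thesis
        by (rule mult_right_le_imp_le)
    qed simp
  qed
  moreover have "closed {z. A * (norm z)\<^sup>2 \<le> inner (frame_op z) z}"
    using bounded_linear_frame_op(1)[OF bessel B]
    by (intro closed_Collect_le continuous_intros linear_continuous_on)
  ultimately have "closure ?R \<subseteq> {z. A * (norm z)\<^sup>2 \<le> inner (frame_op z) z}"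
    by (rule closure_minimal)
  then have "A * (norm z)\<^sup>2 \<le> (\<Sum>\<^sub>\<infinity>k\<in>K. (norm (L k z))\<^sup>2)" for z
    unfolding finite_synthesis_dense[OF assms(2)] inner_frame_op[OF bessel B] by blast
  then show ?thesis
    unfolding frame_bounds_def
    using A B summable_square_L[OF bessel] infsum_square_L_le[OF bessel] by blast
qed

text \<open>The lower Riesz bound controls each single coefficient by every finite partial sum
  containing its index, and the partial sums tend to zero.\<close>

lemma riesz_bounds_has_sum_zero:
  assumes "riesz_bounds K T V A B" "((\<lambda>k. T k (d k)) has_sum 0) K" "k \<in> K"
  shows "T k (d k) = 0"
proof -
  have A: "A > 0"
    using assms(1) by (simp add: riesz_bounds_def)
  \<comment> \<open>The coefficients are first moved into \<open>V k\<close>, where the Riesz bounds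
    apply.\<close>
  have "\<exists>p. \<forall>k\<in>K. p k \<in> V k \<and> T k (p k) = T k (d k)"
    by (rule bchoice) (metis T_eq_at_projection)
  then obtain p where p: "\<And>k. k \<in> K \<Longrightarrow> p k \<in> V k" "\<And>k. k \<in> K \<Longrightarrow> T k (p k) = T k (d k)"
    by blast
  have "A * (norm (p k))\<^sup>2 \<le> 0"
  proof (rule tendsto_lowerbound)
    have "((\<lambda>k. T k (p k)) has_sum 0) K"
      using assms(2) p(2) has_sum_cong by (metis (no_types, lifting))
    then have "(sum (\<lambda>k. T k (p k)) \<longlongrightarrow> 0) (finite_subsets_at_top K)"
      by (simp add: has_sum_def)
    then have "((\<lambda>F. (norm (\<Sum>k\<in>F. T k (p k)))\<^sup>2) \<longlongrightarrow> (norm (0::'z))\<^sup>2) (finite_subsets_at_top K)"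
      by (intro tendsto_power tendsto_norm)
    then show "((\<lambda>F. (norm (\<Sum>k\<in>F. T k (p k)))\<^sup>2) \<longlongrightarrow> 0) (finite_subsets_at_top K)"
      by simp
    have "A * (norm (p k))\<^sup>2 \<le> (norm (\<Sum>k\<in>F. T k (p k)))\<^sup>2"
      if F: "finite F" "{k} \<subseteq> F" "F \<subseteq> K" for F
    proof -
      have "(norm (p k))\<^sup>2 \<le> (\<Sum>k\<in>F. (norm (p k))\<^sup>2)"
        using F by (intro member_le_sum) auto
      then have "A * (norm (p k))\<^sup>2 \<le> A * (\<Sum>k\<in>F. (norm (p k))\<^sup>2)"
        using A by simp
      also have "\<dots> \<le> (norm (\<Sum>k\<in>F. T k (p k)))\<^sup>2"
        using assms(1) F p(1) unfolding riesz_bounds_def by (simp add: subset_iff)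
      finally show ?thesis .
    qed
    then show "\<forall>\<^sub>F F in finite_subsets_at_top K. A * (norm (p k))\<^sup>2 \<le> (norm (\<Sum>k\<in>F. T k (p k)))\<^sup>2"
      using assms(3) unfolding eventually_finite_subsets_at_top
      by (intro exI[of _ "{k}"]) simp
  qed (rule finite_subsets_at_top_neq_bot)
  then have "p k = 0"
    using A by (simp add: mult_le_0_iff)
  then show ?thesis
    using p(2)[OF assms(3)] T_simps(3)[OF assms(3)] by simp
qed

text \<open>Writing \<open>z\<close> as \<open>frame_op w\<close> gives the coefficients
  \<open>L k w\<close>; uniqueness is the previous lemma for the difference of two expansions. In
  this use of \<open>b_basis\<close> the index \<open>k\<close> itself plays the role of the vector
  \<open>x k\<close>.\<close>

lemma riesz_bounds_imp_basis:
  assumes "riesz_bounds K T V A B" "total_on K L"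
  shows "b_basis (\<lambda>h k. T k h) K (\<lambda>k. k)"
  unfolding b_basis_def
proof (intro allI conjI impI ballI)
  fix z
  note frame = riesz_bounds_imp_frame_bounds[OF assms]
  then have "bessel_bound K L B" "B > 0"
    using frame_bounds_imp_bessel_bound by (auto simp: frame_bounds_def)
  moreover obtain w where "frame_op w = z"
    using frame_op_surj[OF frame] by blast
  ultimately show "\<exists>h. ((\<lambda>k. T k (h k)) has_sum z) K"
    using has_sum_frame_op[of B w] by (intro exI[of _ "\<lambda>k. L k w"]) simp
next
  fix z h h' k
  assume h: "((\<lambda>k. T k (h k)) has_sum z) K" and h': "((\<lambda>k. T k (h' k)) has_sum z) K"
    and k: "k \<in> K"
  have "((\<lambda>k. T k (h k) - T k (h' k)) has_sum 0) K"
    using has_sum_add[OF h has_sum_bounded_linear[OF bounded_linear_minus[OF bounded_linear_ident] h']]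
    by simp
  then have "((\<lambda>k. T k (h k - h' k)) has_sum 0) K"
    by (rule has_sum_cong[THEN iffD1, rotated]) (simp add: T_simps)
  then have "T k (h k - h' k) = 0"
    using riesz_bounds_has_sum_zero[OF assms(1), of "\<lambda>k. h k - h' k"] k by simp
  then show "T k (h k) = T k (h' k)"
    using T_simps(2)[OF k] by simp
qed

lemma frame_bounds_imp_total:
  assumes "frame_bounds K L A B"
  shows "total_on K L"
  unfolding total_on_def
proof safe
  fix z assume "\<forall>k\<in>K. L k z = 0"
  then have "(\<Sum>\<^sub>\<infinity>k\<in>K. (norm (L k z))\<^sup>2) = 0"
    by (intro infsum_0) simp
  moreover have "A > 0" "A * (norm z)\<^sup>2 \<le> (\<Sum>\<^sub>\<infinity>k\<in>K. (norm (L k z))\<^sup>2)"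
    using assms by (auto simp: frame_bounds_def)
  ultimately show "z = 0"
    by (simp add: mult_le_0_iff)
qed (simp add: L_simps)

text \<open>\<open>b_basis\<close> determines only the summands \<open>T k (g k)\<close>;
  \<open>inj\<close> recovers \<open>g k\<close> in \<open>V k\<close>. Once \<open>g k\<close>
  equals \<open>L k w\<close>, the sum of the squared norms is \<open>inner z w\<close>, and the
  bound on \<open>w\<close> from \<open>frame_op_surj\<close> finishes the lower estimate.\<close>

lemma frame_bounds_basis_imp_riesz_bounds:
  assumes "frame_bounds K L A B" "b_basis (\<lambda>h k. T k h) K (\<lambda>k. k)"
    and inj: "\<And>k v. k \<in> K \<Longrightarrow> v \<in> V k \<Longrightarrow> T k v = 0 \<Longrightarrow> v = 0"
  shows "riesz_bounds K T V A B"
  unfolding riesz_bounds_def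
proof (intro conjI allI impI)
  show A: "A > 0" and B: "B > 0"
    using assms(1) by (auto simp: frame_bounds_def)
  have bessel: "bessel_bound K L B"
    by (rule frame_bounds_imp_bessel_bound[OF assms(1)])
  fix F g assume F: "finite F" "F \<subseteq> K" and g: "\<forall>k\<in>F. g k \<in> V k"
  define z where "z = (\<Sum>k\<in>F. T k (g k))"
  show "(norm (\<Sum>k\<in>F. T k (g k)))\<^sup>2 \<le> B * (\<Sum>k\<in>F. (norm (g k))\<^sup>2)"
    using bessel B F by (intro synthesis_bound) auto
  obtain w where w: "frame_op w = z" "A * norm w \<le> norm z"
    using frame_op_surj[OF assms(1)] by blast
  \<comment> \<open>Extension by zero makes the finite sum an expansion over \<open>K\<close>,
    comparable with that of \<open>frame_op w\<close>.\<close>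
  define g' where "g' k = (if k \<in> F then g k else 0)" for k
  have "((\<lambda>k. T k (g' k)) has_sum z) K"
  proof -
    have "((\<lambda>k. T k (g k)) has_sum z) F"
      using F by (simp add: z_def has_sum_finite)
    then show ?thesis
      by (rule has_sum_cong_neutral[THEN iffD1, rotated -1]) (use F in \<open>auto simp: g'_def T_simps\<close>)
  qed
  moreover have "((\<lambda>k. T k (L k w)) has_sum z) K"
    using has_sum_frame_op[OF bessel B, of w] w(1) by simp
  ultimately have T_eq: "\<forall>k\<in>K. T k (g' k) = T k (L k w)"
    by (rule assms(2)[unfolded b_basis_def, THEN spec, of z, THEN conjunct2, THEN spec, of g',
          THEN spec, of "\<lambda>k. L k w", THEN mp, THEN mp])
  have g_eq: "g k = L k w" if "k \<in> F" for k
  proof -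
    have k: "k \<in> K" using that F by blast
    have "g k - L k w \<in> V k"
      using g that L_in_V[OF k] subspace_V[OF k] by (simp add: subspace_diff)
    moreover have "T k (g k - L k w) = 0"
      using bspec[OF T_eq k] that by (simp add: g'_def T_simps(2)[OF k])
    ultimately show ?thesis
      using inj[OF k] by force
  qed
  have "(\<Sum>k\<in>F. (norm (g k))\<^sup>2) = (\<Sum>k\<in>F. inner (g k) (L k w))"
    by (intro sum.cong) (auto simp: g_eq power2_norm_eq_inner)
  also have "\<dots> = inner z w"
    using inner_synthesis[OF F(2)] by (simp add: z_def)
  also have "\<dots> \<le> norm z * norm w"
    by (rule norm_cauchy_schwarz)
  finally have "A * (\<Sum>k\<in>F. (norm (g k))\<^sup>2) \<le> A * (norm z * norm w)"
    using A by simp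
  also have "\<dots> = norm z * (A * norm w)"
    by simp
  also have "\<dots> \<le> norm z * norm z"
    using w(2) by (intro mult_left_mono) auto
  finally show "A * (\<Sum>k\<in>F. (norm (g k))\<^sup>2) \<le> (norm (\<Sum>k\<in>F. T k (g k)))\<^sup>2"
    by (simp add: z_def power2_eq_square)
qed

end

section \<open>Spaces over the real or complex field\<close>

context hilbert_space_over
begin

lemma ip_add_right: "ip x (y + z) = ip x y + ip x z"
  by (metis ip_add_left ip_commute conjg_add)

lemma ip_scale_right: "ip x (scale c y) = conjg c * ip x y"
  by (metis ip_scale_left ip_commute conjg_mult)

text \<open>Expand the squared norm of \<open>x + y\<close> in both inner products. The sum of a
  scalar and its conjugate stands for twice its real part, which the class of scalar fields does not
  provide.\<close>

lemma ip_plus_ip_commuted: "ip x y + ip y x = of_real (2 * inner x y)"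
proof -
  have "of_real ((norm (x + y))\<^sup>2) = of_real ((norm x)\<^sup>2) + ip x y + (ip y x + of_real ((norm y)\<^sup>2))"
    unfolding ip_self[symmetric] ip_add_left ip_add_right by (simp add: algebra_simps)
  moreover have "(norm (x + y))\<^sup>2 = (norm x)\<^sup>2 + (norm y)\<^sup>2 + 2 * inner x y"
    unfolding power2_norm_eq_inner by (simp add: algebra_simps inner_commute)
  ultimately show ?thesis
    by simp
qed

lemma ip_right_cancel:
  assumes "\<And>a. ip a x = ip a y"
  shows "x = y"
proof -
  have "ip (x - y) x + ip x (x - y) = ip (x - y) y + ip y (x - y)"
    by (metis assms ip_commute)
  then have "inner (x - y) x = inner (x - y) y"
    unfolding ip_plus_ip_commuted by (subst (asm) of_real_eq_iff) simp
  then have "inner (x - y) (x - y) = 0"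
    by (simp add: inner_diff_right)
  then show ?thesis
    by simp
qed

lemma real_subspace:
  assumes "closed_subspace scale W"
  shows "Real_Vector_Spaces.subspace W" "closed W"
proof -
  have W: "subspace W"
    using assms by (simp add: closed_subspace_def)
  show "Real_Vector_Spaces.subspace W"
    by (intro Real_Vector_Spaces.subspaceI)
      (auto simp: subspace_0[OF W] subspace_add[OF W] subspace_scale[OF W] scale_of_real[symmetric])
  show "closed W"
    using assms by (simp add: closed_subspace_def)
qed

text \<open>Real and scalar-valued orthogonality to \<open>W\<close> agree because \<open>W\<close>
  is closed under scalars, so real orthogonal projections serve for \<open>ip\<close> as
  well.\<close>

lemma in_orth_compl_iff_inner:
  assumes "closed_subspace scale W"
  shows "h \<in> orth_compl ip W \<longleftrightarrow> (\<forall>w\<in>W. inner h w = 0)"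
proof
  assume "h \<in> orth_compl ip W"
  then have "ip h w = 0" "ip w h = 0" if "w \<in> W" for w
    \<comment> \<open>This instance of \<open>conjg_add\<close> yields
      \<open>conjg 0 = 0\<close>.\<close>
    using that ip_commute[of w h] conjg_add[of 0 "0::'f"] by (auto simp: orth_compl_def)
  then have "of_real (2 * inner h w) = (of_real 0 :: 'f)" if "w \<in> W" for w
    using that by (simp only: ip_plus_ip_commuted[symmetric]) simp
  then show "\<forall>w\<in>W. inner h w = 0"
    by (simp only: of_real_eq_iff) simp
next
  assume orth: "\<forall>w\<in>W. inner h w = 0"
  have "ip h w = 0" if w: "w \<in> W" for w
  proof -
    \<comment> \<open>Scaling \<open>w\<close> by this value turns the pairing with \<open>h\<close>
      into the squared modulus of \<open>ip h w\<close>.\<close>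
    let ?c = "ip h w"
    have "scale ?c w \<in> W"
      using w assms by (auto simp: closed_subspace_def intro: subspace_scale)
    then have "ip h (scale ?c w) + ip (scale ?c w) h = 0"
      using orth by (simp add: ip_plus_ip_commuted)
    then have "2 *\<^sub>R (?c * conjg ?c) = 0"
      by (simp add: ip_scale_right ip_scale_left ip_commute[of w h] scaleR_2 mult.commute)
    then show ?thesis
      by (simp add: mult_conjg)
  qed
  then show "h \<in> orth_compl ip W"
    by (simp add: orth_compl_def)
qed

lemma continuous_scale: "continuous_on UNIV (scale c)"
proof (rule linear_continuous_on, rule bounded_linear_intro)
  show "scale c (r *\<^sub>R x) = r *\<^sub>R scale c x" for r x
    by (simp add: scale_of_real[symmetric] mult.commute)
  show "norm (scale c x) \<le> norm x * norm c" for x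
    by (simp add: norm_scale)
qed (rule scale_right_distrib)

lemma closed_subspace_closure:
  assumes "subspace W"
  shows "closed_subspace scale (closure W)"
proof -
  have "Real_Vector_Spaces.subspace W"
    by (intro Real_Vector_Spaces.subspaceI)
      (auto simp: subspace_0 subspace_add subspace_scale assms scale_of_real[symmetric])
  then have real: "Real_Vector_Spaces.subspace (closure W)"
    by (rule subspace_closure)
  have "scale c ` closure W \<subseteq> closure W" for c
  proof (rule image_closure_subset)
    show "continuous_on (closure W) (scale c)"
      using continuous_scale continuous_on_subset by blast
    show "scale c ` W \<subseteq> closure W"
      using subspace_scale[OF assms] closure_subset by blast
  qed simp
  then have "subspace (closure W)"
    by (intro subspaceI)
      (auto intro: Real_Vector_Spaces.subspace_add[OF real] Real_Vector_Spaces.subspace_0[OF real])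
  then show ?thesis
    by (simp add: closed_subspace_def)
qed

end

lemma bounded_op_imp_bounded_linear:
  assumes "normed_space_over scA" "normed_space_over scB" "bounded_op scA scB T"
  shows "bounded_linear T"
proof -
  interpret A: normed_space_over scA by fact
  interpret B: normed_space_over scB by fact
  from assms(3) obtain M where lin: "Vector_Spaces.linear scA scB T"
    and M: "\<And>x. norm (T x) \<le> M * norm x"
    unfolding bounded_op_def by blast
  interpret T: Vector_Spaces.linear scA scB T by (rule lin)
  show ?thesis
  proof (rule bounded_linear_intro)
    show "T (r *\<^sub>R x) = r *\<^sub>R T x" for r x
      using T.scale[of "of_real r" x] by (simp add: A.scale_of_real B.scale_of_real)
    show "norm (T x) \<le> norm x * M" for x
      using M[of x] by (simp add: mult.commute)
  qed (rule T.add)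
qed

section \<open>Adjoints between two Hilbert spaces\<close>

locale hilbert_space_pair =
  Z: hilbert_space_over scZ ipZ + H: hilbert_space_over scH ipH
  for scZ :: "'f::real_or_complex_field \<Rightarrow> 'z::{real_inner, complete_space} \<Rightarrow> 'z"
    and ipZ :: "'z \<Rightarrow> 'z \<Rightarrow> 'f"
    and scH :: "'f \<Rightarrow> 'h::{real_inner, complete_space} \<Rightarrow> 'h"
    and ipH :: "'h \<Rightarrow> 'h \<Rightarrow> 'f"
begin

lemma ip_adjoint_imp_inner_adjoint:
  assumes "\<And>h z. ipZ (T h) z = ipH h (L z)"
  shows "inner (T h) z = inner h (L z)"
proof -
  have "ipZ (T h) z + ipZ z (T h) = ipH h (L z) + ipH (L z) h"
    by (metis assms Z.ip_commute H.ip_commute)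
  then show ?thesis
    unfolding Z.ip_plus_ip_commuted H.ip_plus_ip_commuted by (subst (asm) of_real_eq_iff) simp
qed

text \<open>A scalar-linear functional \<open>e\<close> with zero real part vanishes: evaluate it at \<open>conjg (e h) \<cdot> h\<close>.\<close>

lemma inner_adjoint_imp_ip_adjoint:
  assumes lin: "Vector_Spaces.linear scH scZ T" and eq: "\<And>h. inner (T h) z = inner h g"
  shows "ipZ (T h) z = ipH h g"
proof -
  interpret T: Vector_Spaces.linear scH scZ T by (rule lin)
  define e where "e h = ipZ (T h) z - ipH h g" for h
  have scale: "e (scH c h) = c * e h" for c h
    by (simp add: e_def T.scale Z.ip_scale_left H.ip_scale_left right_diff_distrib)
  have conjg_diff: "conjg (a - c) = conjg a - conjg c" for a c :: 'f
    by (metis add_diff_cancel_right' conjg_add diff_add_cancel)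
  have zero: "e h + conjg (e h) = 0" for h
  proof -
    have "e h + conjg (e h) = (ipZ (T h) z + ipZ z (T h)) - (ipH h g + ipH g h)"
      by (simp add: e_def conjg_diff Z.ip_commute[of z] H.ip_commute[of g])
    then show ?thesis
      by (simp add: Z.ip_plus_ip_commuted H.ip_plus_ip_commuted eq)
  qed
  let ?c = "conjg (e h)"
  have "?c * e h + conjg (?c * e h) = 0"
    using zero[of "scH ?c h"] by (simp add: scale)
  moreover have "conjg (?c * e h) = ?c * e h"
    by (simp add: conjg_mult conjg_conjg mult.commute)
  ultimately have "2 *\<^sub>R (e h * conjg (e h)) = 0"
    by (simp add: scaleR_2 mult.commute)
  then have "e h = 0"
    by (simp add: mult_conjg)
  then show ?thesis
    by (simp add: e_def)
qed

text \<open>Real Riesz representation gives \<open>L z\<close> pointwise; the identity is then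
  lifted to the scalar-valued products, whose nondegeneracy forces linearity of
  \<open>L\<close>.\<close>

lemma adjoint_exists:
  assumes "bounded_op scH scZ T"
  obtains L where "bounded_op scZ scH L" "\<And>h z. ipZ (T h) z = ipH h (L z)"
proof -
  have lin: "Vector_Spaces.linear scH scZ T"
    using assms by (simp add: bounded_op_def)
  obtain M0 where M0: "\<And>h. norm (T h) \<le> M0 * norm h"
    using assms by (auto simp: bounded_op_def)
  \<comment> \<open>On the trivial space \<open>M0\<close> may be negative.\<close>
  define M where "M = \<bar>M0\<bar>"
  have M: "M \<ge> 0" "norm (T h) \<le> M * norm h" for h
    using M0[of h] mult_right_mono[OF abs_ge_self[of M0], of "norm h"] by (auto simp: M_def)
  have bl: "bounded_linear T"
    by (rule bounded_op_imp_bounded_linear[OF H.normed_space_over_axioms Z.normed_space_over_axioms assms])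
  have "\<exists>g. \<forall>h. inner (T h) z = inner h g" for z
    by (rule riesz_representation[OF bounded_linear_compose[OF bounded_linear_inner_left[of z] bl]]) blast
  then obtain L where L: "\<And>z h. inner (T h) z = inner h (L z)"
    by metis
  have adj: "ipZ (T h) z = ipH h (L z)" for h z
    using inner_adjoint_imp_ip_adjoint[OF lin L] .
  have "Vector_Spaces.linear scZ scH L"
  proof (unfold_locales)
    show "L (x + y) = L x + L y" for x y
      by (rule H.ip_right_cancel) (simp add: adj[symmetric] Z.ip_add_right H.ip_add_right)
    show "L (scZ c x) = scH c (L x)" for c x
      by (rule H.ip_right_cancel) (simp add: adj[symmetric] Z.ip_scale_right H.ip_scale_right)
  qed
  moreover have "norm (L z) \<le> M * norm z" for z
  proof (cases "L z = 0")
    case True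
    then show ?thesis
      using M(1) by simp
  next
    case False
    have "norm (L z) * norm (L z) = inner (T (L z)) z"
      unfolding L by (simp add: dot_square_norm power2_eq_square)
    also have "\<dots> \<le> norm (T (L z)) * norm z"
      by (rule norm_cauchy_schwarz)
    also have "\<dots> \<le> (M * norm (L z)) * norm z"
      using M(2) by (intro mult_right_mono) auto
    finally show ?thesis
      using False by (simp add: mult_ac)
  qed
  ultimately have "bounded_op scZ scH L"
    unfolding bounded_op_def by blast
  then show ?thesis
    using adj by (rule that)
qed

text \<open>Adjointness is symmetric up to conjugation, and \<open>ip_right_cancel\<close> supplies
  the uniqueness required by the definite description.\<close>

lemma adjoint_op_eq:
  assumes "\<And>h z. ipZ (T h) z = ipH h (L z)"
  shows "adjoint_op ipZ ipH L = T"
proof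
  fix y
  have "ipH (L a) y = ipZ a (T y)" for a
    by (metis assms Z.ip_commute H.ip_commute)
  then show "adjoint_op ipZ ipH L y = T y"
    unfolding adjoint_op_def by (intro the_equality) (auto intro: Z.ip_right_cancel)
qed

end

section \<open>The correspondence\<close>

text \<open>Both parts of the theorem are instances. The type of \<open>x k\<close> carries no
  structure here, since \<open>x k\<close> enters only through the operator
  \<open>\<lambda>h. b h (x k)\<close>.\<close>

locale b_g_correspondence = hilbert_space_pair scZ ipZ scH ipH
  for scZ :: "'f::real_or_complex_field \<Rightarrow> 'z::{real_inner, complete_space} \<Rightarrow> 'z"
    and ipZ :: "'z \<Rightarrow> 'z \<Rightarrow> 'f"
    and scH :: "'f \<Rightarrow> 'h::{real_inner, complete_space} \<Rightarrow> 'h"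
    and ipH :: "'h \<Rightarrow> 'h \<Rightarrow> 'f" +
  fixes K :: "'k set"
    and b :: "'h \<Rightarrow> 'b \<Rightarrow> 'z"
    and x :: "'k \<Rightarrow> 'b"
    and L :: "'k \<Rightarrow> 'z \<Rightarrow> 'h"
    and V :: "'k \<Rightarrow> 'h set"
  assumes bounded_op_b: "k \<in> K \<Longrightarrow> bounded_op scH scZ (\<lambda>h. b h (x k))"
    and ip_b: "k \<in> K \<Longrightarrow> ipZ (b h (x k)) z = ipH h (L k z)"
    and g_system: "g_system scZ scH K L V"
begin

sublocale adjoint_family K "\<lambda>k h. b h (x k)" L V
proof (rule adjoint_family.intro)
  fix k assume k: "k \<in> K"
  show "inner (b h (x k)) z = inner h (L k z)" for h z
    by (rule ip_adjoint_imp_inner_adjoint[of "\<lambda>h. b h (x k)" "L k"]) (rule ip_b[OF k])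
  show "bounded_linear (\<lambda>h. b h (x k))"
    by (rule bounded_op_imp_bounded_linear[OF H.normed_space_over_axioms
          Z.normed_space_over_axioms bounded_op_b[OF k]])
  have V: "closed_subspace scH (V k)" and L: "bounded_op scZ scH (L k)" "range (L k) \<subseteq> V k"
    using g_system k by (auto simp: g_system_def)
  show "bounded_linear (L k)"
    by (rule bounded_op_imp_bounded_linear[OF Z.normed_space_over_axioms
          H.normed_space_over_axioms L(1)])
  show "subspace (V k)" "closed (V k)"
    using H.real_subspace[OF V] by auto
  show "L k z \<in> V k" for z
    using L(2) by blast
qed

lemma b_frame_prod_eq: "k \<in> K \<Longrightarrow> b_frame_prod ipH ipZ b z (x k) = L k z"
  unfolding b_frame_prod_def
  by (intro the_equality) (auto simp: ip_b intro: H.ip_right_cancel[symmetric])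

lemma adjoint_op_L: "k \<in> K \<Longrightarrow> adjoint_op ipZ ipH (L k) = (\<lambda>h. b h (x k))"
  by (rule adjoint_op_eq) (rule ip_b)

lemma b_frame_bounds_iff: "b_frame_bounds ipH ipZ b K x A B \<longleftrightarrow> frame_bounds K L A B"
proof -
  have "((\<lambda>k. (norm (b_frame_prod ipH ipZ b z (x k)))\<^sup>2) summable_on K) =
      ((\<lambda>k. (norm (L k z))\<^sup>2) summable_on K)"
    and "(\<Sum>\<^sub>\<infinity>k\<in>K. (norm (b_frame_prod ipH ipZ b z (x k)))\<^sup>2) = (\<Sum>\<^sub>\<infinity>k\<in>K. (norm (L k z))\<^sup>2)" for z
    by (auto intro!: summable_on_cong infsum_cong simp: b_frame_prod_eq)
  then show ?thesis
    unfolding b_frame_bounds_def frame_bounds_def by simp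
qed

lemma g_frame_bounds_iff: "g_frame_bounds scZ scH K L V A B \<longleftrightarrow> frame_bounds K L A B"
  unfolding g_frame_bounds_def frame_bounds_def using g_system by simp

lemma b_frame_bounds_iff_g_frame_bounds:
  "b_frame_bounds ipH ipZ b K x A B \<longleftrightarrow> g_frame_bounds scZ scH K L V A B"
  by (simp add: b_frame_bounds_iff g_frame_bounds_iff)

lemma b_frame_iff_g_frame: "b_frame ipH ipZ b K x \<longleftrightarrow> g_frame scZ scH K L V"
  by (simp add: b_frame_def g_frame_def b_frame_bounds_iff g_frame_bounds_iff)

lemma b_basis_iff: "b_basis (\<lambda>h k. b h (x k)) K (\<lambda>k. k) \<longleftrightarrow> b_basis b K x"
  by (simp add: b_basis_def)

lemma g_Riesz_basis_iff:
  "g_Riesz_basis scZ ipZ scH ipH K L V \<longleftrightarrow>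
     total_on K L \<and> (\<exists>A B. riesz_bounds K (\<lambda>k h. b h (x k)) V A B)"
proof -
  have "(\<Sum>k\<in>F. adjoint_op ipZ ipH (L k) (g k)) = (\<Sum>k\<in>F. b (g k) (x k))" if "F \<subseteq> K" for F g
    using that by (intro sum.cong) (auto simp: adjoint_op_L)
  then have "g_Riesz_basis scZ ipZ scH ipH K L V \<longleftrightarrow> total_on K L \<and>
     (\<exists>A>0. \<exists>B>0. \<forall>F g. finite F \<longrightarrow> F \<subseteq> K \<longrightarrow> (\<forall>k\<in>F. g k \<in> V k) \<longrightarrow>
        A * (\<Sum>k\<in>F. (norm (g k))\<^sup>2) \<le> (norm (\<Sum>k\<in>F. b (g k) (x k)))\<^sup>2 \<and>
        (norm (\<Sum>k\<in>F. b (g k) (x k)))\<^sup>2 \<le> B * (\<Sum>k\<in>F. (norm (g k))\<^sup>2))"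
    unfolding g_Riesz_basis_def total_on_def using g_system by (simp cong: imp_cong)
  then show ?thesis
    by (simp add: riesz_bounds_def)
qed

lemma g_Riesz_basis_imp_b_Riesz_basis:
  assumes "g_Riesz_basis scZ ipZ scH ipH K L V"
  shows "b_Riesz_basis ipH ipZ b K x"
proof -
  obtain A B where "total_on K L" "riesz_bounds K (\<lambda>k h. b h (x k)) V A B"
    using assms g_Riesz_basis_iff by blast
  then have "frame_bounds K L A B" "b_basis b K x"
    using riesz_bounds_imp_frame_bounds riesz_bounds_imp_basis b_basis_iff by blast+
  then show ?thesis
    unfolding b_Riesz_basis_def b_frame_def b_frame_bounds_iff by blast
qed

text \<open>Here \<open>inj\<close> will come from density of the range of \<open>L k\<close> in
  \<open>V k\<close> in the first part, and from the kernel condition in the second.\<close>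

lemma b_Riesz_basis_imp_g_Riesz_basis:
  assumes "b_Riesz_basis ipH ipZ b K x"
    and inj: "\<And>k v. k \<in> K \<Longrightarrow> v \<in> V k \<Longrightarrow> b v (x k) = 0 \<Longrightarrow> v = 0"
  shows "g_Riesz_basis scZ ipZ scH ipH K L V"
proof -
  obtain A B where frame: "frame_bounds K L A B"
    using assms(1) unfolding b_Riesz_basis_def b_frame_def b_frame_bounds_iff by blast
  moreover have "riesz_bounds K (\<lambda>k h. b h (x k)) V A B"
    using frame assms(1) inj unfolding b_Riesz_basis_def b_basis_iff[symmetric]
    by (intro frame_bounds_basis_imp_riesz_bounds) auto
  ultimately show ?thesis
    unfolding g_Riesz_basis_iff using frame_bounds_imp_total by blast
qed

text \<open>Summability is recorded separately, since equal values of \<open>infsum\<close> could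
  otherwise both be the default 0.\<close>

lemma frame_operators:
  assumes "b_frame ipH ipZ b K x"
  shows "(\<lambda>k. b (b_frame_prod ipH ipZ b z (x k)) (x k)) summable_on K"
    and "b_frame_operator ipH ipZ b K x z = g_frame_operator ipZ ipH K L z"
proof -
  obtain A B where "frame_bounds K L A B"
    using assms unfolding b_frame_def b_frame_bounds_iff by blast
  then have "bessel_bound K L B" "B > 0"
    using frame_bounds_imp_bessel_bound by (auto simp: frame_bounds_def)
  then have "(\<lambda>k. b (L k z) (x k)) summable_on K"
    by (rule summable_frame_op)
  then show "(\<lambda>k. b (b_frame_prod ipH ipZ b z (x k)) (x k)) summable_on K"
    by (rule summable_on_cong[THEN iffD1, rotated]) (simp add: b_frame_prod_eq)
  show "b_frame_operator ipH ipZ b K x z = g_frame_operator ipZ ipH K L z"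
    unfolding b_frame_operator_def g_frame_operator_def
    by (intro infsum_cong) (simp add: b_frame_prod_eq adjoint_op_L)
qed

end

section \<open>The two instances and the theorem\<close>

lemma b_frame_prod_correspondence:
  fixes scZ :: "'f::real_or_complex_field \<Rightarrow> 'z::{real_inner, complete_space} \<Rightarrow> 'z"
    and scB :: "'f \<Rightarrow> 'b::real_normed_vector \<Rightarrow> 'b"
    and scH :: "'f \<Rightarrow> 'h::{real_inner, complete_space} \<Rightarrow> 'h"
    and x :: "'k \<Rightarrow> 'b"
  assumes "hilbert_space_over scZ ipZ" "hilbert_space_over scH ipH"
    and b: "continuous_bilinear scH scB scZ b"
  defines "L \<equiv> \<lambda>k z. b_frame_prod ipH ipZ b z (x k)"
  shows "b_g_correspondence scZ ipZ scH ipH K b x L (\<lambda>k. closure (range (L k)))"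
proof -
  interpret hilbert_space_pair scZ ipZ scH ipH
    using assms(1,2) by (simp add: hilbert_space_pair_def)
  obtain M where lin: "\<And>y. Vector_Spaces.linear scH scZ (\<lambda>h. b h y)"
    and M: "\<And>h y. norm (b h y) \<le> M * norm h * norm y"
    using b unfolding continuous_bilinear_def by blast
  have op: "bounded_op scH scZ (\<lambda>h. b h y)" for y
    unfolding bounded_op_def
  proof (intro conjI exI allI)
    show "norm (b h y) \<le> (M * norm y) * norm h" for h
      using M[of h y] by (simp add: mult_ac)
  qed (rule lin)
  have adj: "bounded_op scZ scH (L k) \<and> (\<forall>h z. ipZ (b h (x k)) z = ipH h (L k z))" for k
  proof -
    obtain L' where L': "bounded_op scZ scH L'" "\<And>h z. ipZ (b h (x k)) z = ipH h (L' z)"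
      using adjoint_exists[OF op[of "x k"]] by blast
    \<comment> \<open>Existence of the adjoint and cancellation resolve the definite description in
      \<open>b_frame_prod\<close>.\<close>
    have "L k = L'"
      unfolding L_def b_frame_prod_def L'(2)
      by (intro ext the_equality) (auto intro: H.ip_right_cancel)
    then show ?thesis
      using L' by simp
  qed
  have "closed_subspace scH (closure (range (L k)))" for k
  proof (rule H.closed_subspace_closure)
    interpret Lk: Vector_Spaces.linear scZ scH "L k"
      using adj[of k] by (simp add: bounded_op_def)
    show "H.subspace (range (L k))"
      by (rule Lk.subspace_image) (rule Z.subspace_UNIV)
  qed
  then have "g_system scZ scH K L (\<lambda>k. closure (range (L k)))"
    unfolding g_system_def using adj closure_subset by blast
  then show ?thesis
    using op adj by unfold_locales auto
qed

text \<open>Split \<open>h\<close> into its projection \<open>p\<close> onto \<open>W k\<close> and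
  a rest in the complement. The rest contributes nothing on either side: \<open>x k\<close>
  annihilates it, and it is orthogonal to \<open>L k z\<close>, which lies in
  \<open>W k\<close>.\<close>

lemma b0_correspondence:
  fixes scZ :: "'f::real_or_complex_field \<Rightarrow> 'z::{real_inner, complete_space} \<Rightarrow> 'z"
    and scH :: "'f \<Rightarrow> 'h::{real_inner, complete_space} \<Rightarrow> 'h"
    and x :: "'k \<Rightarrow> ('h \<Rightarrow>\<^sub>L 'z)"
  assumes "hilbert_space_over scZ ipZ" "hilbert_space_over scH ipH"
    and g_system: "g_system scZ scH K L W"
    and lin: "\<And>k. k \<in> K \<Longrightarrow> Vector_Spaces.linear scH scZ (blinfun_apply (x k))"
    and x_W: "\<And>k h. k \<in> K \<Longrightarrow> h \<in> W k \<Longrightarrow> x k h = adjoint_op ipZ ipH (L k) h"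
    and x_compl: "\<And>k h. k \<in> K \<Longrightarrow> h \<in> orth_compl ipH (W k) \<Longrightarrow> x k h = 0"
  shows "b_g_correspondence scZ ipZ scH ipH K b0 x L W"
proof -
  interpret hilbert_space_pair scZ ipZ scH ipH
    using assms(1,2) by (simp add: hilbert_space_pair_def)
  \<comment> \<open>Roles exchanged, because the adjoint of \<open>L k\<close> is now
    sought.\<close>
  interpret swap: hilbert_space_pair scH ipH scZ ipZ
    using assms(1,2) by (simp add: hilbert_space_pair_def)
  have "ipZ (x k h) z = ipH h (L k z)" if k: "k \<in> K" for k h z
  proof -
    have W: "closed_subspace scH (W k)" and L: "bounded_op scZ scH (L k)" "range (L k) \<subseteq> W k"
      using g_system k by (auto simp: g_system_def)
    obtain T where T: "\<And>z h. ipH (L k z) h = ipZ z (T h)"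
      using swap.adjoint_exists[OF L(1)] by blast
    then have adj: "ipZ (T h) z = ipH h (L k z)" for h z
      by (metis Z.ip_commute H.ip_commute)
    obtain p where p: "p \<in> W k" "\<And>w. w \<in> W k \<Longrightarrow> inner (h - p) w = 0"
      using orthogonal_decomposition[OF H.real_subspace[OF W]] by blast
    have compl: "h - p \<in> orth_compl ipH (W k)"
      using H.in_orth_compl_iff_inner W p(2) by blast
    interpret xk: Vector_Spaces.linear scH scZ "blinfun_apply (x k)"
      by (rule lin[OF k])
    have "x k h = T p"
      using x_compl[OF k compl] x_W[OF k p(1)] adjoint_op_eq[OF adj] by (simp add: xk.diff)
    moreover have "ipH h (L k z) = ipH p (L k z)"
      using compl L(2) H.ip_add_left[of "h - p" p "L k z"] by (auto simp: orth_compl_def)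
    ultimately show ?thesis
      by (simp add: adj)
  qed
  moreover have "bounded_op scH scZ (x k)" if "k \<in> K" for k
    unfolding bounded_op_def
    using lin[OF that] norm_blinfun[of "x k"] by blast
  ultimately show ?thesis
    using g_system by unfold_locales (auto simp: b0_def)
qed

theorem theorem5p1:
  fixes K :: "'k set"
    and scZ :: "'f::real_or_complex_field \<Rightarrow> 'z::{real_inner, complete_space} \<Rightarrow> 'z"
    and ipZ :: "'z \<Rightarrow> 'z \<Rightarrow> 'f"
    and scB :: "'f \<Rightarrow> 'b::banach \<Rightarrow> 'b"
    and scH1 :: "'f \<Rightarrow> 'h1::{real_inner, complete_space} \<Rightarrow> 'h1"
    and ipH1 :: "'h1 \<Rightarrow> 'h1 \<Rightarrow> 'f"
    and b :: "'h1 \<Rightarrow> 'b \<Rightarrow> 'z"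
    and x1 :: "'k \<Rightarrow> 'b"
    and scH2 :: "'f \<Rightarrow> 'h2::{real_inner, complete_space} \<Rightarrow> 'h2"
    and ipH2 :: "'h2 \<Rightarrow> 'h2 \<Rightarrow> 'f"
    and W :: "'k \<Rightarrow> 'h2 set"
    and L :: "'k \<Rightarrow> 'z \<Rightarrow> 'h2"
    and x2 :: "'k \<Rightarrow> ('h2 \<Rightarrow>\<^sub>L 'z)"
  assumes "countable K"
    and "hilbert_space_over scZ ipZ"
    and "\<exists>D::'z set. countable D \<and> closure D = UNIV"
  shows
    "(normed_space_over scB \<and>
      hilbert_space_over scH1 ipH1 \<and> (\<exists>D::'h1 set. countable D \<and> closure D = UNIV) \<and>
      continuous_bilinear scH1 scB scZ b
      \<longrightarrow>
      (let \<Lambda> = (\<lambda>k z. b_frame_prod ipH1 ipZ b z (x1 k));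
           V = (\<lambda>k. closure (range (\<Lambda> k)))
       in (b_frame ipH1 ipZ b K x1 \<longleftrightarrow> g_frame scZ scH1 K \<Lambda> V) \<and>
          (b_Riesz_basis ipH1 ipZ b K x1 \<longleftrightarrow> g_Riesz_basis scZ ipZ scH1 ipH1 K \<Lambda> V) \<and>
          (\<forall>A B. b_frame_bounds ipH1 ipZ b K x1 A B \<longleftrightarrow> g_frame_bounds scZ scH1 K \<Lambda> V A B) \<and>
          (b_frame ipH1 ipZ b K x1 \<longrightarrow>
             (\<forall>z. (\<lambda>k. b (b_frame_prod ipH1 ipZ b z (x1 k)) (x1 k)) summable_on K \<and>
                  b_frame_operator ipH1 ipZ b K x1 z = g_frame_operator ipZ ipH1 K \<Lambda> z))))
     \<and>
     (hilbert_space_over scH2 ipH2 \<and> hilbert_direct_sum scH2 ipH2 K W \<and>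
      g_system scZ scH2 K L W \<and>
      (\<forall>k\<in>K. Vector_Spaces.linear scH2 scZ (blinfun_apply (x2 k)) \<and>
              (\<forall>h\<in>W k. x2 k h = adjoint_op ipZ ipH2 (L k) h) \<and>
              (\<forall>h\<in>orth_compl ipH2 (W k). x2 k h = 0))
      \<longrightarrow>
      (g_frame scZ scH2 K L W \<longleftrightarrow> b_frame ipH2 ipZ b0 K x2) \<and>
      (g_Riesz_basis scZ ipZ scH2 ipH2 K L W \<longrightarrow> b_Riesz_basis ipH2 ipZ b0 K x2) \<and>
      ((\<forall>k\<in>K. {h. x2 k h = 0} = orth_compl ipH2 (W k)) \<longrightarrow>
         (g_Riesz_basis scZ ipZ scH2 ipH2 K L W \<longleftrightarrow> b_Riesz_basis ipH2 ipZ b0 K x2)) \<and>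
      (\<forall>A B. g_frame_bounds scZ scH2 K L W A B \<longleftrightarrow> b_frame_bounds ipH2 ipZ b0 K x2 A B) \<and>
      (g_frame scZ scH2 K L W \<longrightarrow>
         (\<forall>z. (\<lambda>k. b0 (b_frame_prod ipH2 ipZ b0 z (x2 k)) (x2 k)) summable_on K \<and>
              b_frame_operator ipH2 ipZ b0 K x2 z = g_frame_operator ipZ ipH2 K L z)))"
proof (rule conjI[OF impI impI], goal_cases)
  case 1
  then have spaces: "hilbert_space_over scH1 ipH1" "continuous_bilinear scH1 scB scZ b"
    by auto
  define L1 where "L1 = (\<lambda>k z. b_frame_prod ipH1 ipZ b z (x1 k))"
  interpret b_g_correspondence scZ ipZ scH1 ipH1 K b x1 L1 "\<lambda>k. closure (range (L1 k))"
    unfolding L1_def by (rule b_frame_prod_correspondence[OF assms(2) spaces])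
  \<comment> \<open>Such a \<open>v\<close> is orthogonal to the range of \<open>L1 k\<close>, hence
    to its closure, which contains \<open>v\<close> itself.\<close>
  have "v = 0" if k: "k \<in> K" and v: "v \<in> closure (range (L1 k))" and "b v (x1 k) = 0" for k v
  proof -
    have "range (L1 k) \<subseteq> {w. inner v w = 0}"
      using adj[OF k, of v] that(3) by auto
    moreover have "closed {w. inner v w = 0}"
      by (intro closed_Collect_eq continuous_intros)
    ultimately have "closure (range (L1 k)) \<subseteq> {w. inner v w = 0}"
      by (rule closure_minimal)
    then show ?thesis
      using v by auto
  qed
  then have "b_Riesz_basis ipH1 ipZ b K x1 \<longleftrightarrow>
      g_Riesz_basis scZ ipZ scH1 ipH1 K L1 (\<lambda>k. closure (range (L1 k)))"
    using g_Riesz_basis_imp_b_Riesz_basis b_Riesz_basis_imp_g_Riesz_basis by blast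
  then show ?case
    unfolding Let_def L1_def[symmetric]
    using b_frame_iff_g_frame frame_operators b_frame_bounds_iff_g_frame_bounds
    by (simp add: L1_def)
next
  case 2
  then have H2: "hilbert_space_over scH2 ipH2" and sys: "g_system scZ scH2 K L W"
    and x2: "\<And>k. k \<in> K \<Longrightarrow> Vector_Spaces.linear scH2 scZ (blinfun_apply (x2 k))"
      "\<And>k h. k \<in> K \<Longrightarrow> h \<in> W k \<Longrightarrow> x2 k h = adjoint_op ipZ ipH2 (L k) h"
      "\<And>k h. k \<in> K \<Longrightarrow> h \<in> orth_compl ipH2 (W k) \<Longrightarrow> x2 k h = 0"
    by auto
  interpret b_g_correspondence scZ ipZ scH2 ipH2 K b0 x2 L W
    by (rule b0_correspondence[OF assms(2) H2 sys x2])
  \<comment> \<open>The kernel condition puts \<open>v\<close> into both \<open>W k\<close> and its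
    orthogonal complement.\<close>
  have "v = 0" if "{h. x2 k h = 0} = orth_compl ipH2 (W k)" "v \<in> W k" "b0 v (x2 k) = 0" for k v
  proof -
    have "v \<in> orth_compl ipH2 (W k)"
      using that(1,3) by (auto simp: b0_def)
    then have "ipH2 v v = 0"
      using that(2) by (simp add: orth_compl_def)
    then show ?thesis
      by (simp add: H.ip_self)
  qed
  then have "b_Riesz_basis ipH2 ipZ b0 K x2 \<longrightarrow> g_Riesz_basis scZ ipZ scH2 ipH2 K L W"
    if "\<forall>k\<in>K. {h. x2 k h = 0} = orth_compl ipH2 (W k)"
    using that b_Riesz_basis_imp_g_Riesz_basis by blast
  then show ?case
    using b_frame_iff_g_frame frame_operators g_Riesz_basis_imp_b_Riesz_basis
      b_frame_bounds_iff_g_frame_bounds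
    by blast
qed

end
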